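(* Let $\Pi:\mathcal P\to\mathcal P$ be a map satisfying the properties (i)–(v) listed in the context, let $\boldsymbol p\in\mathcal P$ be the underlying distribution on the countable set $\mathcal S$, let $0<\alpha<1$, $d\in\{1,2\}$, and let $$\hat{\boldsymbol\phi}_n=\beta^{(L_d)}_n\Pi(\hat{\boldsymbol p}_n)+(1-\beta^{(L_d)}_n)\hat{\boldsymbol p}_n$$ be the stacked estimator with mixture parameter selected by leave-one-out cross-validation with loss $L_d$. Let $\hat q^{\,d}_{\alpha,n}$ be the $\alpha$-quantile of $\|\boldsymbol Y_{\hat{\boldsymbol\phi}_n}\|_\infty$, and consider the band $$I_{n,j}=\Big[\max\Big\{\hat\phi_{n,j}-\frac{\hat q^{\,d}_{\alpha,n}}{n^{1/2}},\,0\Big\},\ \hat\phi_{n,j}+\frac{\hat q^{\,d}_{\alpha,n}}{n^{1/2}}\Big]\qquad(j\in\mathbb N).$$ Then, for both choices $d=1,2$ of the loss, this band is an asymptotically correct global confidence band if $\Pi(\boldsymbol p)\neq\boldsymbol p$, i.e. $$\lim_{n\to\infty}\mathbb P\big(p_j\in I_{n,j}\text{ for all }j\in\mathbb N\big)=1-\alpha,$$ and it is an asymptotically correct conservative global confidence band if $\Pi(\boldsymbol p)=\boldsymbol p$, i.e. $$\liminf_{n\to\infty}\mathbb P\big(p_j\in I_{n,j}\text{ for all }j\in\mathbb N\big)\ge1-\alpha.$$ (When $\hat{\boldsymbol\phi}_n$ is the Grenander–Stone estimator, i.e. $\Pi$ is the isotonic regression map, the two cases are: $\boldsymbol p$ is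 not isotonic, and $\boldsymbol p$ is isotonic, respectively.)
   Context: Notation. $\mathcal S=\{\boldsymbol s_0,\boldsymbol s_1,\dots\}$ is a countable set with a partial order $\preceq$; vectors are indexed by $j\in\mathbb N=\{0,1,\dots\}$ (coordinate $j$ corresponds to $\boldsymbol s_j$; finite vectors are extended by zeros). $\mathcal P=\{\boldsymbol f\in\ell_1:\ f_j\ge0,\ \sum_jf_j=1\}$. $\|\cdot\|_k$ is the $\ell_k$-norm ($k\in\{1,2,\dots\}\cup\{\infty\}$), $\langle\cdot,\cdot\rangle$ the $\ell_2$ inner product. $b_n=O_p(1)$ means: for every $\varepsilon>0$ there are finite $M,N>0$ with $\mathbb P(|b_n|>M)<\varepsilon$ for all $n>N$. Isotonic regression (used only for the Grenander–Stone case). $\boldsymbol f\in\mathcal P$ is isotonic if $\boldsymbol s_i\preceq\boldsymbol s_j$ implies $f_i\le f_j$; $\mathcal P^{is}$ is the set of isotonic probability vectors; the isotonic regression map sends $\boldsymbol g\in\mathcal P$ to its $\ell_2$-projection $\arg\min_{\boldsymbol f\in\mathcal P^{is}}\sum_j(f_j-g_j)^2$ onto $\mathcal P^{is}$. Gaussian process and quantiles. For $\boldsymbol f\in\mathcal P$, $\boldsymbol Y_{\boldsymbol f}$ is a Gaussian process in $\ell_2$ with mean zero and covariance operator $C$ given by $\langle C\boldsymbol e_i,\boldsymbol e_{i'}\rangle=f_i\delta_{i,i'}-f_if_{i'}$, where $(\boldsymbol e_i)$ is the standard orthonormal basis of $\ell_2$ and $\delta_{i,i'}$ is the Kronecker delta.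 The $\alpha$-quantile $q$ of $\|\boldsymbol Y_{\boldsymbol f}\|_\infty$ is defined by $\mathbb P(\|\boldsymbol Y_{\boldsymbol f}\|_\infty>q)=\alpha$. For $\boldsymbol Y_{\hat{\boldsymbol\phi}_n}$ the probability is taken with the data (hence $\hat{\boldsymbol\phi}_n$) held fixed. Data. $\boldsymbol z_1,\boldsymbol z_2,\dots$ are i.i.d. $\mathcal S$-valued with p.m.f. $\boldsymbol p$. For each $n$: $x_j=\sum_{i=1}^n1\{\boldsymbol z_i=\boldsymbol s_j\}$, $\boldsymbol x=(x_0,\dots,x_{t_n})$ with $t_n=\sup\{j:x_j>0\}$, $\hat p_{n,j}=x_j/n$. For $n\ge2$ and $j$ with $x_j>0$: $\hat{\boldsymbol p}^{\backslash[j]}_n=(\boldsymbol x-\boldsymbol\sigma^{[j]})/(n-1)$, where $\boldsymbol\sigma^{[j]}$ has entry $1$ at index $j$ and $0$ elsewhere, and $\hat{\boldsymbol g}^{\backslash[j]}_n=\Pi(\hat{\boldsymbol p}^{\backslash[j]}_n)$; for $j$ with $x_j=0$ put $\hat{\boldsymbol g}^{\backslash[j]}_n=0$. Mixture parameters selected by leave-one-out cross-validation. For loss $L_1$: $\beta^{(L_1)}_n=0$ if $\sum_{j=0}^{t_n}\{(x_j-n\hat g^{\backslash[j]}_{n,j})^2+(n+1)\hat g^{\backslash[j]}_{n,j}(x_j-n\hat g^{\backslash[j]}_{n,j})+n(\hat g^{\backslash[j]}_{n,j})^2\}\ge n$, and $\beta^{(L_1)}_n=1$ otherwise. For loss $L_2$: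 $\beta^{(L_2)}_n=b_n/a_n$ if $a_n\neq0$ and $0\le b_n\le a_n$; $\beta^{(L_2)}_n=0$ if $a_n=0$ or $b_n<0$; $\beta^{(L_2)}_n=1$ otherwise, where $$a_n=n-\sum_{j=0}^{t_n}x_j\Big\{2(x_j-\hat g^{\backslash[j]}_{n,j}(n-1))-\sum_{k=0}^{t_n}(x_k-(n-1)\hat g^{\backslash[j]}_{n,k})^2\Big\},$$ $$b_n=n^2-\sum_{j=0}^{t_n}x_j^2+(n-1)\sum_{j=0}^{t_n}x_j\sum_{k=0}^{t_n}x_k(\hat g^{\backslash[k]}_{n,k}-\hat g^{\backslash[j]}_{n,k}).$$ Properties of the map $\Pi:\mathcal P\to\mathcal P$: (i) $\Pi$ is continuous from $\ell_2$ to $\ell_2$. (ii) $\Pi$ is a contraction with respect to the $\ell_\infty$-norm, i.e. $\|\Pi(\boldsymbol f)-\Pi(\boldsymbol h)\|_\infty\le\|\boldsymbol f-\boldsymbol h\|_\infty$. (iii) $\langle\Pi(\boldsymbol f),\boldsymbol f-\Pi(\boldsymbol f)\rangle=0$ and $\langle\boldsymbol f,\boldsymbol f-\Pi(\boldsymbol f)\rangle\ge0$ for every $\boldsymbol f\in\mathcal P$. (iv) There is a real sequence $c_n\to1$ such that for any frequency data $\boldsymbol x$ (of sample size $n$), $c_n\hat{\boldsymbol\gamma}_n\le\Pi(\hat{\boldsymbol p}_n)$ coordinatewise, where $\hat\gamma_{n,j}=\Pi(\hat{\boldsymbol p}^{\backslash[j]}_n)_j$ if $x_j>0$ and $\hat\gamma_{n,j}=0$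 otherwise. (v) If the true distribution satisfies $\Pi(\boldsymbol p)=\boldsymbol p$, then $n^{1/2}\|\Pi(\hat{\boldsymbol p}_n)-\boldsymbol p\|_k=O_p(1)$ for $2\le k\le\infty$, and if in addition $\sum_{j}\sqrt{p_j}<\infty$, then $n^{1/2}\|\Pi(\hat{\boldsymbol p}_n)-\boldsymbol p\|_1=O_p(1)$.
   Formalization: The limit 1−α in the case Π(p)≠p is proved for p not a point mass; for a point mass the estimator equals p, Y vanishes almost surely, and the α-quantile defined by P(‖Y‖_∞>q)=α does not exist. *)

theory Defs
  imports "HOL-Probability.Probability"
begin

(* Vectors are functions nat => real.  The countable set S is enumerated by an
   index set J of natural numbers through a bijection s: J = UNIV gives an infinite
   S = {s 0, s 1, ...}, J = {..<K} a finite one; coordinates outside J are zero. *)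

definition lnorm :: "enat \<Rightarrow> (nat \<Rightarrow> real) \<Rightarrow> real" where
  "lnorm k f = (case k of enat m \<Rightarrow> root m (\<Sum>j. \<bar>f j\<bar> ^ m) | \<infinity> \<Rightarrow> (SUP j. \<bar>f j\<bar>))"

definition l2_space :: "(nat \<Rightarrow> real) set" where
  "l2_space = {f. summable (\<lambda>j. (f j)\<^sup>2)}"

definition l2_inner :: "(nat \<Rightarrow> real) \<Rightarrow> (nat \<Rightarrow> real) \<Rightarrow> real" where
  "l2_inner f h = (\<Sum>j. f j * h j)"

definition prob_vectors :: "nat set \<Rightarrow> (nat \<Rightarrow> real) set" where
  "prob_vectors J = {f. (\<forall>j. 0 \<le> f j) \<and> (\<forall>j. j \<notin> J \<longrightarrow> f j = 0) \<and> f sums 1}"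

definition bounded_in_prob :: "'a measure \<Rightarrow> (nat \<Rightarrow> 'a \<Rightarrow> real) \<Rightarrow> bool" where
  "bounded_in_prob M b \<longleftrightarrow>
     (\<forall>\<epsilon>>0. \<exists>B>0. \<exists>N>0. \<forall>n>N. measure M {\<omega> \<in> space M. \<bar>b n \<omega>\<bar> > B} < \<epsilon>)"


subsection \<open>Isotonic regression\<close>

definition isotonic :: "nat set \<Rightarrow> (nat \<Rightarrow> 's) \<Rightarrow> ('s \<times> 's) set \<Rightarrow> (nat \<Rightarrow> real) \<Rightarrow> bool" where
  "isotonic J s r f \<longleftrightarrow> (\<forall>i\<in>J. \<forall>j\<in>J. (s i, s j) \<in> r \<longrightarrow> f i \<le> f j)"

definition isotonic_prob_vectors ::
    "nat set \<Rightarrow> (nat \<Rightarrow> 's) \<Rightarrow> ('s \<times> 's) set \<Rightarrow> (nat \<Rightarrow> real) set" where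
  "isotonic_prob_vectors J s r = {f \<in> prob_vectors J. isotonic J s r f}"

definition is_isotonic_regression ::
    "nat set \<Rightarrow> (nat \<Rightarrow> 's) \<Rightarrow> ('s \<times> 's) set \<Rightarrow> ((nat \<Rightarrow> real) \<Rightarrow> nat \<Rightarrow> real) \<Rightarrow> bool" where
  "is_isotonic_regression J s r \<Psi> \<longleftrightarrow>
     (\<forall>g\<in>prob_vectors J.
        is_arg_min (\<lambda>f. \<Sum>j. (f j - g j)\<^sup>2) (\<lambda>f. f \<in> isotonic_prob_vectors J s r) (\<Psi> g))"


subsection \<open>Gaussian processes in \<open>\<ell>\<^sub>2\<close> and quantiles of their sup-norm\<close>

(* Constants count as (degenerate) Gaussian random variables. *)
definition gaussian_rv :: "'b measure \<Rightarrow> ('b \<Rightarrow> real) \<Rightarrow> bool" where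
  "gaussian_rv N X \<longleftrightarrow>
     X \<in> borel_measurable N \<and>
     (\<exists>\<mu> \<sigma>. (0 < \<sigma> \<and> distributed N lborel X (\<lambda>x. ennreal (normal_density \<mu> \<sigma> x)))
            \<or> (AE \<omega> in N. X \<omega> = \<mu>))"

(* y is a Gaussian random element of l2 with mean zero and covariance operator C,
   <C e_i, e_i'> = E (y_i y_i') = f_i delta_{i,i'} - f_i f_i'. *)
definition gaussian_process :: "'b measure \<Rightarrow> (nat \<Rightarrow> real) \<Rightarrow> (nat \<Rightarrow> 'b \<Rightarrow> real) \<Rightarrow> bool" where
  "gaussian_process N f y \<longleftrightarrow>
     (\<forall>j. y j \<in> borel_measurable N) \<and>
     (\<forall>\<omega>\<in>space N. (\<lambda>j. y j \<omega>) \<in> l2_space) \<and>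
     (\<forall>u\<in>l2_space. gaussian_rv N (\<lambda>\<omega>. l2_inner (\<lambda>j. y j \<omega>) u)) \<and>
     (\<forall>j. integral\<^sup>L N (y j) = 0) \<and>
     (\<forall>i i'. integral\<^sup>L N (\<lambda>\<omega>. y i \<omega> * y i' \<omega>) = (if i = i' then f i else 0) - f i * f i')"

(* The defining equation has no solution when f is a point mass, where y = 0 almost
   surely; the value 0 is then used. *)
definition sup_quantile :: "'b measure \<Rightarrow> (nat \<Rightarrow> 'b \<Rightarrow> real) \<Rightarrow> real \<Rightarrow> real" where
  "sup_quantile N y \<alpha> =
     (let tail = (\<lambda>q. measure N {\<omega> \<in> space N. lnorm \<infinity> (\<lambda>j. y j \<omega>) > q})
      in if \<exists>q. tail q = \<alpha> then SOME q. tail q = \<alpha> else 0)"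


subsection \<open>Data and estimators\<close>

definition freq :: "nat set \<Rightarrow> (nat \<Rightarrow> 's) \<Rightarrow> (nat \<Rightarrow> 'a \<Rightarrow> 's) \<Rightarrow> nat \<Rightarrow> 'a \<Rightarrow> nat \<Rightarrow> nat" where
  "freq J s z n \<omega> j = (if j \<in> J then card {i \<in> {1..n}. z i \<omega> = s j} else 0)"

definition freq_data :: "nat set \<Rightarrow> nat \<Rightarrow> (nat \<Rightarrow> nat) \<Rightarrow> bool" where
  "freq_data J n x \<longleftrightarrow>
     finite {j. x j > 0} \<and> {j. x j > 0} \<subseteq> J \<and> (\<Sum>j | x j > 0. x j) = n"

definition t_max :: "(nat \<Rightarrow> nat) \<Rightarrow> nat" where
  "t_max x = Sup {j. x j > 0}"

definition emp :: "nat \<Rightarrow> (nat \<Rightarrow> nat) \<Rightarrow> nat \<Rightarrow> real" where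
  "emp n x j = real (x j) / real n"

definition emp_loo :: "nat \<Rightarrow> (nat \<Rightarrow> nat) \<Rightarrow> nat \<Rightarrow> nat \<Rightarrow> real" where
  "emp_loo n x j k = (real (x k) - (if k = j then 1 else 0)) / (real n - 1)"

definition g_loo ::
    "((nat \<Rightarrow> real) \<Rightarrow> nat \<Rightarrow> real) \<Rightarrow> nat \<Rightarrow> (nat \<Rightarrow> nat) \<Rightarrow> nat \<Rightarrow> nat \<Rightarrow> real" where
  "g_loo \<Psi> n x j = (if x j > 0 then \<Psi> (emp_loo n x j) else (\<lambda>_. 0))"

definition beta_L1 :: "((nat \<Rightarrow> real) \<Rightarrow> nat \<Rightarrow> real) \<Rightarrow> nat \<Rightarrow> (nat \<Rightarrow> nat) \<Rightarrow> real" where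
  "beta_L1 \<Psi> n x =
     (if (\<Sum>j\<le>t_max x.
            (real (x j) - real n * g_loo \<Psi> n x j j)\<^sup>2
            + (real n + 1) * g_loo \<Psi> n x j j * (real (x j) - real n * g_loo \<Psi> n x j j)
            + real n * (g_loo \<Psi> n x j j)\<^sup>2) \<ge> real n
      then 0 else 1)"

definition a_L2 :: "((nat \<Rightarrow> real) \<Rightarrow> nat \<Rightarrow> real) \<Rightarrow> nat \<Rightarrow> (nat \<Rightarrow> nat) \<Rightarrow> real" where
  "a_L2 \<Psi> n x =
     real n - (\<Sum>j\<le>t_max x. real (x j) *
       (2 * (real (x j) - g_loo \<Psi> n x j j * (real n - 1))
        - (\<Sum>k\<le>t_max x. (real (x k) - (real n - 1) * g_loo \<Psi> n x j k)\<^sup>2)))"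

definition b_L2 :: "((nat \<Rightarrow> real) \<Rightarrow> nat \<Rightarrow> real) \<Rightarrow> nat \<Rightarrow> (nat \<Rightarrow> nat) \<Rightarrow> real" where
  "b_L2 \<Psi> n x =
     (real n)\<^sup>2 - (\<Sum>j\<le>t_max x. (real (x j))\<^sup>2)
     + (real n - 1) * (\<Sum>j\<le>t_max x. real (x j) *
         (\<Sum>k\<le>t_max x. real (x k) * (g_loo \<Psi> n x k k - g_loo \<Psi> n x j k)))"

definition beta_L2 :: "((nat \<Rightarrow> real) \<Rightarrow> nat \<Rightarrow> real) \<Rightarrow> nat \<Rightarrow> (nat \<Rightarrow> nat) \<Rightarrow> real" where
  "beta_L2 \<Psi> n x =
     (if a_L2 \<Psi> n x \<noteq> 0 \<and> 0 \<le> b_L2 \<Psi> n x \<and> b_L2 \<Psi> n x \<le> a_L2 \<Psi> n x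
      then b_L2 \<Psi> n x / a_L2 \<Psi> n x
      else if a_L2 \<Psi> n x = 0 \<or> b_L2 \<Psi> n x < 0 then 0
      else 1)"

(* d is the index of the loss, 1 or 2. *)
definition mixture_beta ::
    "nat \<Rightarrow> ((nat \<Rightarrow> real) \<Rightarrow> nat \<Rightarrow> real) \<Rightarrow> nat \<Rightarrow> (nat \<Rightarrow> nat) \<Rightarrow> real" where
  "mixture_beta d \<Psi> n x = (if d = 1 then beta_L1 \<Psi> n x else beta_L2 \<Psi> n x)"

definition stacked ::
    "nat \<Rightarrow> ((nat \<Rightarrow> real) \<Rightarrow> nat \<Rightarrow> real) \<Rightarrow> nat \<Rightarrow> (nat \<Rightarrow> nat) \<Rightarrow> nat \<Rightarrow> real" where
  "stacked d \<Psi> n x j =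
     mixture_beta d \<Psi> n x * \<Psi> (emp n x) j + (1 - mixture_beta d \<Psi> n x) * emp n x j"

definition band :: "(nat \<Rightarrow> real) \<Rightarrow> real \<Rightarrow> nat \<Rightarrow> nat \<Rightarrow> real set" where
  "band \<phi> q n j = {max (\<phi> j - q / sqrt (real n)) 0 .. \<phi> j + q / sqrt (real n)}"


subsection \<open>Properties of the map\<close>

definition l2_continuous :: "nat set \<Rightarrow> ((nat \<Rightarrow> real) \<Rightarrow> nat \<Rightarrow> real) \<Rightarrow> bool" where
  "l2_continuous J \<Psi> \<longleftrightarrow>
     (\<forall>f\<in>prob_vectors J. \<forall>\<epsilon>>0. \<exists>\<delta>>0. \<forall>h\<in>prob_vectors J.
        lnorm 2 (\<lambda>j. h j - f j) < \<delta> \<longrightarrow> lnorm 2 (\<lambda>j. \<Psi> h j - \<Psi> f j) < \<epsilon>)"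

definition linf_contraction :: "nat set \<Rightarrow> ((nat \<Rightarrow> real) \<Rightarrow> nat \<Rightarrow> real) \<Rightarrow> bool" where
  "linf_contraction J \<Psi> \<longleftrightarrow>
     (\<forall>f\<in>prob_vectors J. \<forall>h\<in>prob_vectors J.
        lnorm \<infinity> (\<lambda>j. \<Psi> f j - \<Psi> h j) \<le> lnorm \<infinity> (\<lambda>j. f j - h j))"

definition projection_like :: "nat set \<Rightarrow> ((nat \<Rightarrow> real) \<Rightarrow> nat \<Rightarrow> real) \<Rightarrow> bool" where
  "projection_like J \<Psi> \<longleftrightarrow>
     (\<forall>f\<in>prob_vectors J.
        l2_inner (\<Psi> f) (\<lambda>j. f j - \<Psi> f j) = 0 \<and> l2_inner f (\<lambda>j. f j - \<Psi> f j) \<ge> 0)"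

definition loo_dominated :: "nat set \<Rightarrow> ((nat \<Rightarrow> real) \<Rightarrow> nat \<Rightarrow> real) \<Rightarrow> bool" where
  "loo_dominated J \<Psi> \<longleftrightarrow>
     (\<exists>c :: nat \<Rightarrow> real. c \<longlonglongrightarrow> 1 \<and>
        (\<forall>n\<ge>2. \<forall>x. freq_data J n x \<longrightarrow> (\<forall>j. c n * g_loo \<Psi> n x j j \<le> \<Psi> (emp n x) j)))"

end

theory Submission
  imports Defs
begin

text \<open>If \<open>\<Psi> p \<noteq> p\<close>, the residual \<open>\<langle>p, p - \<Psi> p\<rangle>\<close> is at least \<open>\<parallel>p - \<Psi> p\<parallel>\<^sup>2 > 0\<close>, and by the contraction
  property its empirical version stays away from 0 near \<open>p\<close>. Both cross-validation rules then
  select \<open>\<beta> = O(1/n)\<close>, so that the stacked and the empirical estimator differ by \<open>o(n\<^sup>-\<^sup>1\<^sup>/\<^sup>2)\<close>. If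
  \<open>\<Psi> p = p\<close>, the stacked estimator is at least as close to \<open>p\<close> in sup-norm as the empirical one.
  It remains to treat the empirical estimator together with the quantile at a random \<open>f\<close> close to
  \<open>p\<close>.

  Convergence in law of the sup-norm of an \<open>\<ell>\<^sub>2\<close>-valued sequence follows from the convergence of
  \<open>E cos \<langle>u, X\<rangle>\<close> for finitely supported \<open>u\<close> and a uniform second moment bound: the event that all
  coordinates are at most \<open>t\<close> is sandwiched by products of cutoffs of period \<open>2A\<close> in the single
  coordinates, and these are uniform limits of polynomials in \<open>cos (\<pi> x\<^sub>j / A)\<close>. The criterion
  applies to the empirical process, by the one-dimensional central limit theorem, and to the
  Gaussian processes \<open>Y f\<close> as \<open>f\<close> tends to \<open>p\<close>. Since the limit law has no atoms, comparing the
  distribution functions at two levels next to \<open>1 - \<alpha>\<close> locates the quantile.\<close>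

subsection \<open>Convergence in law of the supremum norm\<close>

text \<open>Cosines of linear forms are enough and full characteristic functions are avoided: the
  cutoffs are even in each coordinate, and cos a cos b = (cos (a - b) + cos (a + b)) / 2 keeps
  products in the span of such cosines. The price is periodicity. A cutoff is 1 again near the
  nonzero multiples of 2A, so Chebyshev's inequality has to confine the coordinates to one period.
  Past finitely many coordinates there is no cutoff; there the second moments are bounded by weights
  of total mass 1, and since the limiting weights have mass 1 as well, coordinatewise convergence of
  the weights lets no mass escape.

  The quantile is taken at a data-dependent vector, and strict monotonicity of the limiting
  distribution function F is not established, so convergence of quantiles is not derived. It is
  enough to trap the random quantile between points a and b with F a < 1 - \<alpha> < F b and to
  choose both levels close to 1 - \<alpha>. This breaks down for a point mass, whose limit law sits
  at 0; when \<Psi> p = p that case is settled through exact equality of p and the empirical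
  vector.\<close>

inductive trig_poly :: "((nat \<Rightarrow> real) \<Rightarrow> real) \<Rightarrow> bool" where
  trig_poly_cos: "trig_poly (\<lambda>x. cos (\<Sum>j<m. u j * x j))"
| trig_poly_add: "trig_poly f \<Longrightarrow> trig_poly g \<Longrightarrow> trig_poly (\<lambda>x. f x + g x)"
| trig_poly_scale: "trig_poly f \<Longrightarrow> trig_poly (\<lambda>x. c * f x)"

lemma trig_poly_const: "trig_poly (\<lambda>x. c)"
  using trig_poly_scale[OF trig_poly_cos[of "\<lambda>_. 0" 0], of c] by simp

text \<open>The product-to-sum formula for cosines. It produces no sines, which is why the class can
  be generated by cosines alone.\<close>

lemma trig_poly_mult_cos:
  assumes "trig_poly g"
  shows "trig_poly (\<lambda>x. cos (\<Sum>j<m. u j * x j) * g x)"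
  using assms
proof induction
  case (trig_poly_cos u' m')
  \<comment> \<open>Both coefficient vectors are padded with zeros to the common length
    \<open>max m m'\<close>, so that their sum and difference are again coefficient vectors of one
    linear form.\<close>
  define e :: "nat \<Rightarrow> (nat \<Rightarrow> real) \<Rightarrow> nat \<Rightarrow> real" where "e m u j = (if j < m then u j else 0)" for m u j
  have ext: "(\<Sum>j<m. u j * x j) = (\<Sum>j<max m m'. e m u j * x j)"
    "(\<Sum>j<m'. u' j * x j) = (\<Sum>j<max m m'. e m' u' j * x j)" for x :: "nat \<Rightarrow> real"
    by (auto simp: e_def intro!: sum.mono_neutral_cong_left split: if_splits)
  have "cos (\<Sum>j<m. u j * x j) * cos (\<Sum>j<m'. u' j * x j) =
      1/2 * cos (\<Sum>j<max m m'. (e m u j - e m' u' j) * x j) +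
      1/2 * cos (\<Sum>j<max m m'. (e m u j + e m' u' j) * x j)" for x :: "nat \<Rightarrow> real"
    unfolding ext by (simp add: cos_times_cos left_diff_distrib distrib_right sum.distrib sum_subtractf)
  then show ?case
    by (simp only:) (intro trig_poly.intros)
next
  case (trig_poly_add f g)
  then show ?case
    by (simp add: distrib_left trig_poly.trig_poly_add)
next
  case (trig_poly_scale f c)
  then show ?case
    using trig_poly.trig_poly_scale[of "\<lambda>x. cos (\<Sum>j<m. u j * x j) * f x" c]
    by (simp add: mult.left_commute)
qed

lemma trig_poly_mult:
  assumes "trig_poly f" "trig_poly g"
  shows "trig_poly (\<lambda>x. f x * g x)"
  using assms(1)
proof induction
  case (trig_poly_cos u m)
  then show ?case using trig_poly_mult_cos[OF assms(2)] .
next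
  case (trig_poly_add f h)
  then show ?case by (simp add: distrib_right trig_poly.trig_poly_add)
next
  case (trig_poly_scale f c)
  then show ?case
    using trig_poly.trig_poly_scale[of "\<lambda>x. f x * g x" c] by (simp add: mult.assoc)
qed

lemma trig_poly_prod:
  assumes "\<And>i. i < m \<Longrightarrow> trig_poly (f i)"
  shows "trig_poly (\<lambda>x. \<Prod>i<(m::nat). f i x)"
  using assms
proof (induction m)
  case 0
  show ?case using trig_poly_const[of 1] by simp
next
  case (Suc m)
  show ?case
    using trig_poly_mult[OF Suc.IH, of "f m"] Suc.prems by simp
qed

text \<open>The bridge to the Weierstrass theorem: a continuous function of
  \<open>cos (v * x j)\<close> can be approximated by functions of this form.\<close>

lemma trig_poly_real_polynomial:
  assumes "real_polynomial_function g"
  shows "trig_poly (\<lambda>x. g (cos (v * x j)))"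
  using assms
proof induction
  case (linear f)
  obtain c where c: "f = (\<lambda>y. y * c)"
    using linear real_bounded_linear by blast
  moreover have "trig_poly (\<lambda>x. cos (v * x j))"
    using trig_poly_cos[of "\<lambda>i. if i = j then v else 0" "Suc j"] by simp
  ultimately show ?case
    using trig_poly_scale[of "\<lambda>x. cos (v * x j)" c]
    by (simp add: c mult.commute)
next
  case (const c)
  show ?case by (rule trig_poly_const)
next
  case (add f g)
  show ?case by (rule trig_poly_add[OF add.IH])
next
  case (mult f g)
  show ?case by (rule trig_poly_mult[OF mult.IH])
qed

lemma trig_poly_measurable:
  assumes "trig_poly f" "\<And>j. X j \<in> borel_measurable M"
  shows "(\<lambda>\<omega>. f (\<lambda>j. X j \<omega>)) \<in> borel_measurable M"
  using assms(1)
proof induction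
  case (trig_poly_cos u m)
  show ?case using assms(2) by measurable
qed auto

lemma trig_poly_bounded:
  assumes "trig_poly f"
  shows "\<exists>B. \<forall>x. \<bar>f x\<bar> \<le> B"
  using assms
proof induction
  case (trig_poly_cos u m)
  then show ?case by (intro exI[of _ 1]) simp
next
  case (trig_poly_add f g)
  then obtain B C where "\<And>x. \<bar>f x\<bar> \<le> B" "\<And>x. \<bar>g x\<bar> \<le> C" by auto
  then show ?case by (intro exI[of _ "B + C"]) (metis abs_triangle_ineq add_mono order_trans)
next
  case (trig_poly_scale f c)
  then obtain B where "\<And>x. \<bar>f x\<bar> \<le> B" by auto
  then show ?case by (intro exI[of _ "\<bar>c\<bar> * B"]) (simp add: abs_mult mult_left_mono)
qed

lemma (in prob_space) integrable_trig_poly: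
  assumes "trig_poly f" "\<And>j. random_variable borel (X j)"
  shows "integrable M (\<lambda>\<omega>. f (\<lambda>j. X j \<omega>))"
proof -
  obtain B where "\<And>x. \<bar>f x\<bar> \<le> B" using trig_poly_bounded[OF assms(1)] by auto
  then show ?thesis
    by (intro integrable_const_bound[of _ B] AE_I2 trig_poly_measurable[OF assms]) simp
qed

lemma trig_poly_expectation_tendsto:
  fixes Mk :: "nat \<Rightarrow> 'a measure" and M :: "'b measure"
  assumes "trig_poly f" and Mk: "\<And>k. prob_space (Mk k)" and M: "prob_space M"
    and X: "\<And>k j. X k j \<in> borel_measurable (Mk k)" and Y: "\<And>j. Y j \<in> borel_measurable M"
    and cos: "\<And>m u. (\<lambda>k. \<integral>\<omega>. cos (\<Sum>j<m. u j * X k j \<omega>) \<partial>Mk k)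
                 \<longlonglongrightarrow> (\<integral>\<omega>. cos (\<Sum>j<m. u j * Y j \<omega>) \<partial>M)"
  shows "(\<lambda>k. \<integral>\<omega>. f (\<lambda>j. X k j \<omega>) \<partial>Mk k) \<longlonglongrightarrow> (\<integral>\<omega>. f (\<lambda>j. Y j \<omega>) \<partial>M)"
  using assms(1)
proof induction
  case (trig_poly_cos u m)
  then show ?case using cos by simp
next
  case (trig_poly_add f g)
  have "(\<integral>\<omega>. f (\<lambda>j. X k j \<omega>) + g (\<lambda>j. X k j \<omega>) \<partial>Mk k) =
      (\<integral>\<omega>. f (\<lambda>j. X k j \<omega>) \<partial>Mk k) + (\<integral>\<omega>. g (\<lambda>j. X k j \<omega>) \<partial>Mk k)" for k
    using trig_poly_add.hyps prob_space.integrable_trig_poly[OF Mk] X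
    by (intro Bochner_Integration.integral_add) auto
  moreover have "(\<integral>\<omega>. f (\<lambda>j. Y j \<omega>) + g (\<lambda>j. Y j \<omega>) \<partial>M) =
      (\<integral>\<omega>. f (\<lambda>j. Y j \<omega>) \<partial>M) + (\<integral>\<omega>. g (\<lambda>j. Y j \<omega>) \<partial>M)"
    using trig_poly_add.hyps prob_space.integrable_trig_poly[OF M] Y
    by (intro Bochner_Integration.integral_add) auto
  ultimately show ?case
    using trig_poly_add.IH by (simp add: tendsto_add)
next
  case (trig_poly_scale f c)
  then show ?case by (simp add: tendsto_mult_left)
qed

section \<open>Products of continuous functions of cosines\<close>

lemma (in prob_space) expectation_diff_le:
  fixes f g :: "'a \<Rightarrow> real"
  assumes "integrable M f" "integrable M g" "\<And>\<omega>. \<bar>f \<omega> - g \<omega>\<bar> \<le> e"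
  shows "\<bar>expectation f - expectation g\<bar> \<le> e"
proof -
  have "expectation f - expectation g = expectation (\<lambda>\<omega>. f \<omega> - g \<omega>)"
    using assms by simp
  also have "\<bar>\<dots>\<bar> \<le> expectation (\<lambda>\<omega>. \<bar>f \<omega> - g \<omega>\<bar>)"
    using integral_norm_bound[of M "\<lambda>\<omega>. f \<omega> - g \<omega>"] by simp
  also have "\<dots> \<le> expectation (\<lambda>\<omega>. e)"
    using assms by (intro integral_mono) auto
  finally show ?thesis by (simp add: prob_space)
qed

lemma (in prob_space) integrable_prod_bounded:
  fixes H :: "real \<Rightarrow> real"
  assumes "H \<in> borel_measurable borel" "\<And>y. 0 \<le> H y" "\<And>y. H y \<le> 1"
    and "\<And>j. X j \<in> borel_measurable M"
  shows "integrable M (\<lambda>\<omega>. \<Prod>j<(m::nat). H (X j \<omega>))"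
  using assms by (intro integrable_const_bound[of _ 1]) (auto simp: abs_prod intro!: prod_le_1)

text \<open>Each factor is replaced by a polynomial in the cosine, uniformly on the range [-1, 1].
  As all factors are bounded by 1, the errors of the factors add up in the product, and the claim
  for trigonometric polynomials carries over.\<close>

lemma prod_cos_expectation_tendsto:
  fixes Mk :: "nat \<Rightarrow> 'a measure" and M :: "'b measure" and H :: "real \<Rightarrow> real"
  assumes H: "continuous_on {-1..1} H" "\<And>y. 0 \<le> H y" "\<And>y. H y \<le> 1"
    and Hm: "H \<in> borel_measurable borel"
    and Mk: "\<And>k. prob_space (Mk k)" and M: "prob_space M"
    and X: "\<And>k j. X k j \<in> borel_measurable (Mk k)" and Y: "\<And>j. Y j \<in> borel_measurable M"
    and cos: "\<And>m u. (\<lambda>k. \<integral>\<omega>. cos (\<Sum>j<m. u j * X k j \<omega>) \<partial>Mk k)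
                 \<longlonglongrightarrow> (\<integral>\<omega>. cos (\<Sum>j<m. u j * Y j \<omega>) \<partial>M)"
  shows "(\<lambda>k. \<integral>\<omega>. (\<Prod>j<(m::nat). H (cos (v * X k j \<omega>))) \<partial>Mk k)
           \<longlonglongrightarrow> (\<integral>\<omega>. (\<Prod>j<m. H (cos (v * Y j \<omega>))) \<partial>M)"
proof (rule LIMSEQ_I)
  fix r :: real assume r: "0 < r"
  \<comment> \<open>Every factor will cost 2e, hence the product at most 2em \<le> r/4; the summand
    1 keeps the denominator positive for m = 0.\<close>
  define e where "e = r / (8 * (real m + 1))"
  have e: "0 < e" using r by (simp add: e_def)
  obtain g0 where g0: "real_polynomial_function g0" "\<And>y. y \<in> {-1..1} \<Longrightarrow> \<bar>H y - g0 y\<bar> < e"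
    using Stone_Weierstrass_real_polynomial_function[OF compact_Icc H(1) e] by blast
  \<comment> \<open>The approximating polynomial may exceed 1 by e. The rescaling restores the bound
    1 needed for comparing products and costs a second e.\<close>
  define g where "g y = 1 / (1 + e) * g0 y" for y
  have gpol: "real_polynomial_function g"
    unfolding g_def using g0(1) by (intro real_polynomial_function.intros(2,4))
  have g1: "\<bar>g y\<bar> \<le> 1" if "y \<in> {-1..1}" for y
    using g0(2)[OF that] H(2,3)[of y] e by (auto simp: g_def abs_mult divide_simps)
  have g2: "\<bar>H y - g y\<bar> \<le> 2 * e" if "y \<in> {-1..1}" for y
  proof -
    have "H y - g y = ((H y - g0 y) + e * H y) / (1 + e)"
      using e by (simp add: g_def field_simps)
    also have "\<bar>\<dots>\<bar> \<le> \<bar>(H y - g0 y) + e * H y\<bar>"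
      using e by (simp add: abs_divide pos_divide_le_eq mult_le_cancel_left1)
    also have "\<dots> \<le> e + e * 1"
      using g0(2)[OF that] H(2,3)[of y] e
      by (intro order.trans[OF abs_triangle_ineq] add_mono) (auto simp: abs_mult)
    finally show ?thesis by simp
  qed
  define P where "P x = (\<Prod>j<m. H (cos (v * x j)))" for x :: "nat \<Rightarrow> real"
  define Q where "Q x = (\<Prod>j<m. g (cos (v * x j)))" for x :: "nat \<Rightarrow> real"
  have PQ: "\<bar>P x - Q x\<bar> \<le> r / 4" for x
  proof -
    have "norm (P x - Q x) \<le> (\<Sum>j<m. norm (H (cos (v * x j)) - g (cos (v * x j))))"
      unfolding P_def Q_def using H(2,3) g1 by (intro norm_prod_diff) auto
    also have "\<dots> \<le> (\<Sum>j<m. 2 * e)"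
      using g2 by (intro sum_mono) auto
    also have "\<dots> = (real m / (real m + 1)) * (r / 4)"
      by (simp add: e_def divide_simps)
    also have "\<dots> \<le> 1 * (r / 4)"
      using r by (intro mult_right_mono) auto
    finally show ?thesis by simp
  qed
  have Q: "trig_poly Q"
    unfolding Q_def by (intro trig_poly_prod trig_poly_real_polynomial gpol)
  have close_X: "\<bar>(\<integral>\<omega>. P (\<lambda>j. X k j \<omega>) \<partial>Mk k) - (\<integral>\<omega>. Q (\<lambda>j. X k j \<omega>) \<partial>Mk k)\<bar> \<le> r / 4" for k
    by (intro prob_space.expectation_diff_le[OF Mk] PQ prob_space.integrable_trig_poly[OF Mk Q X])
      (unfold P_def, intro prob_space.integrable_prod_bounded[OF Mk] Hm H, use X in measurable)
  have close_Y: "\<bar>(\<integral>\<omega>. P (\<lambda>j. Y j \<omega>) \<partial>M) - (\<integral>\<omega>. Q (\<lambda>j. Y j \<omega>) \<partial>M)\<bar> \<le> r / 4"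
    by (intro prob_space.expectation_diff_le[OF M] PQ prob_space.integrable_trig_poly[OF M Q Y])
      (unfold P_def, intro prob_space.integrable_prod_bounded[OF M] Hm H, use Y in measurable)
  have "(\<lambda>k. \<integral>\<omega>. Q (\<lambda>j. X k j \<omega>) \<partial>Mk k) \<longlonglongrightarrow> (\<integral>\<omega>. Q (\<lambda>j. Y j \<omega>) \<partial>M)"
    using trig_poly_expectation_tendsto[OF Q Mk M X Y cos] .
  from LIMSEQ_D[OF this, of "r / 4"] r obtain n0 where n0: "\<And>n. n \<ge> n0 \<Longrightarrow>
      norm ((\<integral>\<omega>. Q (\<lambda>j. X n j \<omega>) \<partial>Mk n) - (\<integral>\<omega>. Q (\<lambda>j. Y j \<omega>) \<partial>M)) < r / 4"
    by auto
  show "\<exists>n0. \<forall>n\<ge>n0. norm ((\<integral>\<omega>. (\<Prod>j<m. H (cos (v * X n j \<omega>))) \<partial>Mk n)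
        - (\<integral>\<omega>. (\<Prod>j<m. H (cos (v * Y j \<omega>))) \<partial>M)) < r"
  proof (intro exI allI impI)
    fix n assume "n \<ge> n0"
    from n0[OF this]
    have "\<bar>(\<integral>\<omega>. Q (\<lambda>j. X n j \<omega>) \<partial>Mk n) - (\<integral>\<omega>. Q (\<lambda>j. Y j \<omega>) \<partial>M)\<bar> < r / 4"
      by simp
    with close_X[of n]
    have a: "\<bar>(\<integral>\<omega>. P (\<lambda>j. X n j \<omega>) \<partial>Mk n) - (\<integral>\<omega>. Q (\<lambda>j. Y j \<omega>) \<partial>M)\<bar> < r / 2"
      by linarith
    have "\<bar>(\<integral>\<omega>. P (\<lambda>j. Y j \<omega>) \<partial>M) - (\<integral>\<omega>. Q (\<lambda>j. Y j \<omega>) \<partial>M)\<bar> \<le> r / 4"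
      using close_Y .
    with a r show "norm ((\<integral>\<omega>. (\<Prod>j<m. H (cos (v * X n j \<omega>))) \<partial>Mk n)
        - (\<integral>\<omega>. (\<Prod>j<m. H (cos (v * Y j \<omega>))) \<partial>M)) < r"
      unfolding P_def real_norm_def by linarith
  qed
qed

text \<open>Chebyshev's inequality in each coordinate and a union bound. The thresholds vary with
  the coordinate because coordinates with and without a cutoff will be confined to different
  intervals.\<close>

lemma (in prob_space) prob_exists_ge_le:
  fixes X :: "nat \<Rightarrow> 'a \<Rightarrow> real"
  assumes X[measurable]: "\<And>j. random_variable borel (X j)"
    and int: "\<And>j. integrable M (\<lambda>\<omega>. (X j \<omega>)\<^sup>2)"
    and le: "\<And>j. expectation (\<lambda>\<omega>. (X j \<omega>)\<^sup>2) \<le> v j"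
    and a: "\<And>j. 0 < a j" and sm: "summable (\<lambda>j. v j / (a j)\<^sup>2)"
  shows "prob {\<omega> \<in> space M. \<exists>j. a j \<le> \<bar>X j \<omega>\<bar>} \<le> (\<Sum>j. v j / (a j)\<^sup>2)"
proof -
  have each: "prob {\<omega> \<in> space M. a j \<le> \<bar>X j \<omega>\<bar>} \<le> v j / (a j)\<^sup>2" for j
  proof -
    have "{\<omega> \<in> space M. a j \<le> \<bar>X j \<omega>\<bar>} = {\<omega> \<in> space M. (a j)\<^sup>2 \<le> (X j \<omega>)\<^sup>2}"
      using a[of j] abs_le_square_iff[of "a j"] by auto
    also have "prob \<dots> \<le> expectation (\<lambda>\<omega>. (X j \<omega>)\<^sup>2) / (a j)\<^sup>2"
      using a[of j] by (intro integral_Markov_inequality_measure[OF int, of "{}"]) auto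
    also have "\<dots> \<le> v j / (a j)\<^sup>2"
      using a[of j] le by (intro divide_right_mono) auto
    finally show ?thesis .
  qed
  have sm': "summable (\<lambda>j. prob {\<omega> \<in> space M. a j \<le> \<bar>X j \<omega>\<bar>})"
    using each by (intro summable_comparison_test'[OF sm]) simp
  have "{\<omega> \<in> space M. \<exists>j. a j \<le> \<bar>X j \<omega>\<bar>} = (\<Union>j. {\<omega> \<in> space M. a j \<le> \<bar>X j \<omega>\<bar>})"
    by auto
  also have "prob \<dots> \<le> (\<Sum>j. prob {\<omega> \<in> space M. a j \<le> \<bar>X j \<omega>\<bar>})"
    by (intro finite_measure_subadditive_countably sm') auto
  also have "\<dots> \<le> (\<Sum>j. v j / (a j)\<^sup>2)"
    by (intro suminf_le each sm' sm)
  finally show ?thesis .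
qed

text \<open>As a function of the cosine of \<open>pi * x / A\<close> this is a continuous cutoff of period \<open>2 * A\<close>
  in \<open>x\<close>: it equals 1 for \<open>\<bar>x\<bar> \<le> t\<close> and 0 for \<open>s \<le> \<bar>x\<bar> \<le> A\<close>.\<close>

definition cos_cutoff :: "real \<Rightarrow> real \<Rightarrow> real \<Rightarrow> real \<Rightarrow> real" where
  "cos_cutoff t s A y =
     max 0 (min 1 ((y - cos (pi * s / A)) / (cos (pi * t / A) - cos (pi * s / A))))"

lemma cos_cutoff_range: "0 \<le> cos_cutoff t s A y" "cos_cutoff t s A y \<le> 1"
  by (auto simp: cos_cutoff_def)

lemma continuous_on_cos_cutoff:
  assumes "0 \<le> t" "t < s" "s \<le> A"
  shows "continuous_on S (cos_cutoff t s A)"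
proof -
  have "cos (pi * s / A) < cos (pi * t / A)"
    using assms by (intro cos_monotone_0_pi) (auto simp: divide_simps)
  then show ?thesis
    unfolding cos_cutoff_def by (intro continuous_intros) auto
qed

lemma cos_cutoff_eq_1:
  assumes "0 \<le> t" "t < s" "s \<le> A" "\<bar>x\<bar> \<le> t"
  shows "cos_cutoff t s A (cos (pi / A * x)) = 1"
proof -
  have "cos (pi * s / A) < cos (pi * t / A)"
    using assms by (intro cos_monotone_0_pi) (auto simp: divide_simps)
  moreover have "cos (pi * t / A) \<le> cos (pi * \<bar>x\<bar> / A)"
    using assms by (intro cos_monotone_0_pi_le) (auto simp: divide_simps)
  moreover have "cos (pi * \<bar>x\<bar> / A) = cos (pi / A * x)"
    by (cases "0 \<le> x") auto
  ultimately show ?thesis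
    by (auto simp: cos_cutoff_def min_def le_divide_eq)
qed

lemma cos_cutoff_eq_0:
  assumes "0 \<le> t" "t < s" "s \<le> \<bar>x\<bar>" "\<bar>x\<bar> \<le> A"
  shows "cos_cutoff t s A (cos (pi / A * x)) = 0"
proof -
  have "cos (pi * s / A) < cos (pi * t / A)"
    using assms by (intro cos_monotone_0_pi) (auto simp: divide_simps)
  moreover have "cos (pi * \<bar>x\<bar> / A) \<le> cos (pi * s / A)"
    using assms by (intro cos_monotone_0_pi_le) (auto simp: divide_simps)
  moreover have "cos (pi * \<bar>x\<bar> / A) = cos (pi / A * x)"
    by (cases "0 \<le> x") auto
  ultimately show ?thesis
    by (simp add: cos_cutoff_def max_absorb1 divide_nonpos_pos min.coboundedI2)
qed

lemma cos_cutoff_measurable: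
  assumes "0 \<le> t" "t < s" "s \<le> A"
  shows "cos_cutoff t s A \<in> borel_measurable borel"
  using continuous_on_cos_cutoff[OF assms] by (rule borel_measurable_continuous_onI)

text \<open>The product is 1 when all coordinates are within t. Conversely, it can be nonzero
  although some coordinate exceeds s only if one of the first m coordinates reaches A, or a later
  one, which has no cutoff, reaches s. Chebyshev's inequality bounds the two events by the last two
  terms.\<close>

lemma (in prob_space) sup_norm_sandwich:
  fixes X :: "nat \<Rightarrow> 'a \<Rightarrow> real"
  assumes X[measurable]: "\<And>j. random_variable borel (X j)"
    and int: "\<And>j. integrable M (\<lambda>\<omega>. (X j \<omega>)\<^sup>2)"
    and le: "\<And>j. expectation (\<lambda>\<omega>. (X j \<omega>)\<^sup>2) \<le> v j"
    and v: "\<And>j. 0 \<le> v j" "v sums 1"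
    and ts: "0 \<le> t" "t < s" "s \<le> A"
  shows "prob {\<omega> \<in> space M. \<forall>j. \<bar>X j \<omega>\<bar> \<le> t}
          \<le> expectation (\<lambda>\<omega>. \<Prod>j<m. cos_cutoff t s A (cos (pi / A * X j \<omega>)))" (is ?lower)
    and "expectation (\<lambda>\<omega>. \<Prod>j<m. cos_cutoff t s A (cos (pi / A * X j \<omega>)))
          \<le> prob {\<omega> \<in> space M. \<forall>j. \<bar>X j \<omega>\<bar> \<le> s} + 1 / A\<^sup>2 + (1 - (\<Sum>j<m. v j)) / s\<^sup>2" (is ?upper)
proof -
  define h where "h x = cos_cutoff t s A (cos (pi / A * x))" for x
  note [measurable] = cos_cutoff_measurable[OF ts]
  have h[measurable]: "h \<in> borel_measurable borel"
    unfolding h_def by measurable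
  have hr: "0 \<le> h x" "h x \<le> 1" for x
    by (auto simp: h_def cos_cutoff_range)
  have int_h: "integrable M (\<lambda>\<omega>. \<Prod>j<m. h (X j \<omega>))"
    by (intro integrable_prod_bounded h hr X)
  have s: "0 < s" "0 < A" using ts by auto
  define T where "T = {\<omega> \<in> space M. \<forall>j. \<bar>X j \<omega>\<bar> \<le> t}"
  define T' where "T' = {\<omega> \<in> space M. \<forall>j. \<bar>X j \<omega>\<bar> \<le> s}"
  \<comment> \<open>A coordinate with a cutoff only has to stay inside one period; the others have
    to stay below s themselves.\<close>
  define a where "a j = (if j < m then A else s)" for j
  define E where "E = {\<omega> \<in> space M. \<exists>j. a j \<le> \<bar>X j \<omega>\<bar>}"
  have [measurable]: "T \<in> events" "T' \<in> events" "E \<in> events"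
    unfolding T_def T'_def E_def by measurable
  have "prob T = expectation (indicator T)"
    by simp
  also have "\<dots> \<le> expectation (\<lambda>\<omega>. \<Prod>j<m. h (X j \<omega>))"
  proof (intro integral_mono int_h)
    show "indicator T \<omega> \<le> (\<Prod>j<m. h (X j \<omega>))" if "\<omega> \<in> space M" for \<omega>
      using cos_cutoff_eq_1[OF ts] by (auto simp: T_def indicator_def h_def cos_cutoff_range prod_nonneg)
  qed (simp add: emeasure_eq_measure)
  finally show ?lower unfolding T_def h_def .
  have sumv: "(\<lambda>j. v j / (a j)\<^sup>2) sums ((\<Sum>j<m. v j) / A\<^sup>2 + (1 - (\<Sum>j<m. v j)) / s\<^sup>2)"
  proof -
    have "(\<lambda>j. v (j + m) / s\<^sup>2) sums ((1 - (\<Sum>j<m. v j)) / s\<^sup>2)"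
      using sums_split_initial_segment[OF v(2), of m] by (rule sums_divide)
    then have "(\<lambda>j. v (j + m) / (a (j + m))\<^sup>2) sums ((1 - (\<Sum>j<m. v j)) / s\<^sup>2)"
      by (simp add: a_def)
    from sums_iff_shift[THEN iffD1, OF this]
    show ?thesis
      by (simp add: a_def sum_divide_distrib add.commute)
  qed
  have "prob E \<le> (\<Sum>j<m. v j) / A\<^sup>2 + (1 - (\<Sum>j<m. v j)) / s\<^sup>2"
    using prob_exists_ge_le[OF X int le _ sums_summable[OF sumv]] s sums_unique[OF sumv]
    unfolding E_def by (simp add: a_def)
  also have "\<dots> \<le> 1 / A\<^sup>2 + (1 - (\<Sum>j<m. v j)) / s\<^sup>2"
    using sum_le_suminf[OF sums_summable[OF v(2)], of "{..<m}"] v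
    by (intro add_right_mono divide_right_mono) (auto simp: sums_iff)
  finally have E: "prob E \<le> 1 / A\<^sup>2 + (1 - (\<Sum>j<m. v j)) / s\<^sup>2" .
  have "expectation (\<lambda>\<omega>. \<Prod>j<m. h (X j \<omega>)) \<le> expectation (\<lambda>\<omega>. indicator T' \<omega> + indicator E \<omega>)"
  proof (intro integral_mono int_h Bochner_Integration.integrable_add)
    fix \<omega> assume \<omega>: "\<omega> \<in> space M"
    have le1: "(\<Prod>j<m. h (X j \<omega>)) \<le> 1"
      by (intro prod_le_1) (auto simp: hr)
    show "(\<Prod>j<m. h (X j \<omega>)) \<le> indicator T' \<omega> + (indicator E \<omega> :: real)"
    proof (cases "\<omega> \<in> T' \<or> \<omega> \<in> E")
      case True
      then show ?thesis using le1 by (auto simp: indicator_def)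
    next
      case False
      \<comment> \<open>For an index from m on the two bounds would contradict each other, since
        there \<open>a j = s\<close>. So the offending coordinate carries a cutoff, and it lies
        where that cutoff vanishes.\<close>
      with \<omega> obtain j where j: "s < \<bar>X j \<omega>\<bar>" "\<bar>X j \<omega>\<bar> < a j"
        by (auto simp: T'_def E_def not_le)
      then have "j < m" "\<bar>X j \<omega>\<bar> \<le> A"
        by (auto simp: a_def split: if_splits)
      then have "h (X j \<omega>) = 0"
        unfolding h_def using j ts by (intro cos_cutoff_eq_0) auto
      with \<open>j < m\<close> have "(\<Prod>j<m. h (X j \<omega>)) = 0"
        by (intro prod_zero) auto
      then show ?thesis
        unfolding \<open>(\<Prod>j<m. h (X j \<omega>)) = 0\<close> by simp
    qed
  qed (simp_all add: emeasure_eq_measure)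
  also have "\<dots> = prob T' + prob E"
    by (subst Bochner_Integration.integral_add) (auto simp: emeasure_eq_measure)
  finally show ?upper
    using E unfolding T'_def h_def by simp
qed

section \<open>Limits of the distribution functions of the supremum norm\<close>

lemma sup_norm_cdf_eventually_le:
  fixes Mk :: "nat \<Rightarrow> 'a measure" and M :: "'b measure"
    and X :: "nat \<Rightarrow> nat \<Rightarrow> 'a \<Rightarrow> real" and Y :: "nat \<Rightarrow> 'b \<Rightarrow> real"
  assumes Mk: "\<And>k. prob_space (Mk k)" and M: "prob_space M"
    and X: "\<And>k j. X k j \<in> borel_measurable (Mk k)" and Y: "\<And>j. Y j \<in> borel_measurable M"
    and X2: "\<And>k j. integrable (Mk k) (\<lambda>\<omega>. (X k j \<omega>)\<^sup>2)" "\<And>k j. (\<integral>\<omega>. (X k j \<omega>)\<^sup>2 \<partial>Mk k) \<le> v k j"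
    and Y2: "\<And>j. integrable M (\<lambda>\<omega>. (Y j \<omega>)\<^sup>2)" "\<And>j. (\<integral>\<omega>. (Y j \<omega>)\<^sup>2 \<partial>M) \<le> w j"
    and v: "\<And>k j. 0 \<le> v k j" "\<And>k. v k sums 1" and w: "\<And>j. 0 \<le> w j" "w sums 1"
    and vw: "\<And>j. (\<lambda>k. v k j) \<longlonglongrightarrow> w j"
    and cos: "\<And>m u. (\<lambda>k. \<integral>\<omega>. cos (\<Sum>j<m. u j * X k j \<omega>) \<partial>Mk k)
                 \<longlonglongrightarrow> (\<integral>\<omega>. cos (\<Sum>j<m. u j * Y j \<omega>) \<partial>M)"
    and ts: "0 \<le> t" "t < s" and e: "0 < e"
  shows "\<forall>\<^sub>F k in sequentially.
      measure (Mk k) {\<omega> \<in> space (Mk k). \<forall>j. \<bar>X k j \<omega>\<bar> \<le> t}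
        \<le> measure M {\<omega> \<in> space M. \<forall>j. \<bar>Y j \<omega>\<bar> \<le> s} + e" (is ?th1)
    "\<forall>\<^sub>F k in sequentially.
      measure M {\<omega> \<in> space M. \<forall>j. \<bar>Y j \<omega>\<bar> \<le> t}
        \<le> measure (Mk k) {\<omega> \<in> space (Mk k). \<forall>j. \<bar>X k j \<omega>\<bar> \<le> s} + e" (is ?th2)
proof -
  \<comment> \<open>The error e is shared equally by three sources: leaving the period (hence
    \<open>3 / e\<close>), the coordinates from m on, and the convergence of the expected
    products.\<close>
  define A where "A = max s (sqrt (3 / e))"
  have s: "0 < s" using ts by simp
  have A: "s \<le> A" "1 / A\<^sup>2 \<le> e / 3"
  proof -
    show "s \<le> A" by (simp add: A_def)
    have "3 / e = (sqrt (3 / e))\<^sup>2" using e by simp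
    also have "\<dots> \<le> A\<^sup>2" using e by (intro power_mono) (auto simp: A_def)
    finally show "1 / A\<^sup>2 \<le> e / 3"
      using e \<open>s \<le> A\<close> s by (simp add: field_simps)
  qed
  have "(\<lambda>m. \<Sum>j<m. w j) \<longlonglongrightarrow> 1" using w(2) by (simp add: sums_def)
  then have "\<forall>\<^sub>F m in sequentially. 1 - e * s\<^sup>2 / 3 < (\<Sum>j<m. w j)"
    using e s by (intro order_tendstoD(1)) auto
  then obtain m where m: "1 - e * s\<^sup>2 / 3 < (\<Sum>j<m. w j)"
    by (auto simp: eventually_sequentially)
  \<comment> \<open>All weights have total mass 1, so convergence of finitely many of them already
    bounds the mass of the remaining ones, with one m for all large k.\<close>
  have "(\<lambda>k. \<Sum>j<m. v k j) \<longlonglongrightarrow> (\<Sum>j<m. w j)"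
    by (intro tendsto_sum vw)
  then have ev1: "\<forall>\<^sub>F k in sequentially. 1 - e * s\<^sup>2 / 3 < (\<Sum>j<m. v k j)"
    using m by (rule order_tendstoD(1))
  have tail: "(1 - S) / s\<^sup>2 \<le> e / 3" if "1 - e * s\<^sup>2 / 3 < S" for S
    using that s by (simp add: field_simps)
  let ?P = "\<lambda>k. \<integral>\<omega>. (\<Prod>j<m. cos_cutoff t s A (cos (pi / A * X k j \<omega>))) \<partial>Mk k"
  let ?Q = "\<integral>\<omega>. (\<Prod>j<m. cos_cutoff t s A (cos (pi / A * Y j \<omega>))) \<partial>M"
  have "?P \<longlonglongrightarrow> ?Q"
    by (intro prod_cos_expectation_tendsto continuous_on_cos_cutoff ts A cos_cutoff_range
        cos_cutoff_measurable Mk M X Y cos)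
  then have "\<forall>\<^sub>F k in sequentially. dist (?P k) ?Q < e / 3"
    using e by (intro tendstoD) auto
  then have ev2: "\<forall>\<^sub>F k in sequentially. \<bar>?P k - ?Q\<bar> < e / 3"
    by (simp add: dist_real_def)
  note sX = prob_space.sup_norm_sandwich[OF Mk X X2 v ts A(1)]
  note sY = prob_space.sup_norm_sandwich[OF M Y Y2 w ts A(1)]
  show ?th1
    using ev2
  proof eventually_elim
    case (elim k)
    then show ?case
      using sX(1)[of k m] sY(2)[of m] tail[OF m] A(2) by linarith
  qed
  show ?th2
    using ev1 ev2
  proof eventually_elim
    case (elim k)
    then show ?case
      using sY(1)[of m] sX(2)[of k m] tail[OF elim(1)] A(2) by linarith
  qed
qed

lemma sup_norm_cdf_tendsto:
  fixes Mk :: "nat \<Rightarrow> 'a measure" and M :: "'b measure"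
    and X :: "nat \<Rightarrow> nat \<Rightarrow> 'a \<Rightarrow> real" and Y :: "nat \<Rightarrow> 'b \<Rightarrow> real"
  assumes Mk: "\<And>k. prob_space (Mk k)" and M: "prob_space M"
    and X: "\<And>k j. X k j \<in> borel_measurable (Mk k)" and Y: "\<And>j. Y j \<in> borel_measurable M"
    and X2: "\<And>k j. integrable (Mk k) (\<lambda>\<omega>. (X k j \<omega>)\<^sup>2)" "\<And>k j. (\<integral>\<omega>. (X k j \<omega>)\<^sup>2 \<partial>Mk k) \<le> v k j"
    and Y2: "\<And>j. integrable M (\<lambda>\<omega>. (Y j \<omega>)\<^sup>2)" "\<And>j. (\<integral>\<omega>. (Y j \<omega>)\<^sup>2 \<partial>M) \<le> w j"
    and v: "\<And>k j. 0 \<le> v k j" "\<And>k. v k sums 1" and w: "\<And>j. 0 \<le> w j" "w sums 1"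
    and vw: "\<And>j. (\<lambda>k. v k j) \<longlonglongrightarrow> w j"
    and cos: "\<And>m u. (\<lambda>k. \<integral>\<omega>. cos (\<Sum>j<m. u j * X k j \<omega>) \<partial>Mk k)
                 \<longlonglongrightarrow> (\<integral>\<omega>. cos (\<Sum>j<m. u j * Y j \<omega>) \<partial>M)"
    and cont: "isCont (\<lambda>t. measure M {\<omega> \<in> space M. \<forall>j. \<bar>Y j \<omega>\<bar> \<le> t}) t"
  shows "(\<lambda>k. measure (Mk k) {\<omega> \<in> space (Mk k). \<forall>j. \<bar>X k j \<omega>\<bar> \<le> t})
           \<longlonglongrightarrow> measure M {\<omega> \<in> space M. \<forall>j. \<bar>Y j \<omega>\<bar> \<le> t}"
proof -
  let ?G = "\<lambda>k t. measure (Mk k) {\<omega> \<in> space (Mk k). \<forall>j. \<bar>X k j \<omega>\<bar> \<le> t}"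
  let ?F = "\<lambda>t. measure M {\<omega> \<in> space M. \<forall>j. \<bar>Y j \<omega>\<bar> \<le> t}"
  \<comment> \<open>The comparison was proved for nonnegative levels only, but
    \<open>t - d / 2\<close> may be negative; there both distribution functions vanish.\<close>
  have "(\<forall>j. \<bar>f j\<bar> \<le> u) = False" if "u < 0" for u and f :: "nat \<Rightarrow> real"
    using that abs_ge_zero[of "f 0"] by (metis not_le order.strict_trans1)
  then have neg: "?F u = 0" "?G k u = 0" if "u < 0" for u k
    using that by (simp_all only: simp_thms Collect_const if_False measure_empty)
  have le: "\<forall>\<^sub>F k in sequentially. ?G k u \<le> ?F u' + e" "\<forall>\<^sub>F k in sequentially. ?F u \<le> ?G k u' + e"
    if "u < u'" "0 < e" for u u' e
    using sup_norm_cdf_eventually_le[OF Mk M X Y X2 Y2 v w vw cos _ that]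
    by (cases "0 \<le> u"; use neg[of u] that in \<open>simp add: add_nonneg_nonneg\<close>)+
  show ?thesis
  proof (rule tendstoI)
    fix e :: real assume e: "0 < e"
    from cont have "\<exists>d>0. \<forall>u. \<bar>u - t\<bar> < d \<longrightarrow> \<bar>?F u - ?F t\<bar> < e / 2"
      unfolding continuous_at_eps_delta dist_real_def using e half_gt_zero by blast
    then obtain d where d: "0 < d" "\<And>u. \<bar>u - t\<bar> < d \<Longrightarrow> \<bar>?F u - ?F t\<bar> < e / 2"
      by blast
    have Fd: "\<bar>?F (t + d / 2) - ?F t\<bar> < e / 2" "\<bar>?F (t - d / 2) - ?F t\<bar> < e / 2"
      by (intro d(2); use d(1) in simp)+
    have "\<forall>\<^sub>F k in sequentially. ?G k t \<le> ?F (t + d / 2) + e / 3"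
      "\<forall>\<^sub>F k in sequentially. ?F (t - d / 2) \<le> ?G k t + e / 3"
      by (intro le; use d(1) e in simp)+
    then show "\<forall>\<^sub>F k in sequentially. dist (?G k t) (?F t) < e"
    proof eventually_elim
      case (elim k)
      then show ?case
        unfolding dist_real_def using Fd e by linarith
    qed
  qed
qed

subsection \<open>The sup-norm of a Gaussian process\<close>

text \<open>Constants count as Gaussian, so both alternatives are treated. A centred constant is 0
  almost surely and satisfies the cosine formula with variance 0; a nonzero variance forces the
  density alternative, which has no atoms.\<close>

lemma (in prob_space) gaussian_rv_centered:
  assumes X: "gaussian_rv M X" and mean: "expectation X = 0"
  shows "integrable M (\<lambda>\<omega>. (X \<omega>)\<^sup>2)" (is ?int)
    and "expectation (\<lambda>\<omega>. cos (X \<omega>)) = exp (- expectation (\<lambda>\<omega>. (X \<omega>)\<^sup>2) / 2)" (is ?cos)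
    and "expectation (\<lambda>\<omega>. (X \<omega>)\<^sup>2) \<noteq> 0 \<Longrightarrow> AE \<omega> in M. X \<omega> \<noteq> c" (is "_ \<Longrightarrow> ?null")
proof -
  have Xm[measurable]: "X \<in> borel_measurable M" using X by (simp add: gaussian_rv_def)
  consider \<mu> \<sigma> where "0 < \<sigma>" "distributed M lborel X (\<lambda>x. ennreal (normal_density \<mu> \<sigma> x))"
    | \<mu> where "AE \<omega> in M. X \<omega> = \<mu>"
    using X by (auto simp: gaussian_rv_def)
  then have "?int \<and> ?cos \<and> (expectation (\<lambda>\<omega>. (X \<omega>)\<^sup>2) \<noteq> 0 \<longrightarrow> ?null)"
  proof cases
    case 1
    have \<mu>: "\<mu> = 0" using normal_distributed_expectation[OF 1] mean by simp
    note D = 1(2)[unfolded \<mu>]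
    have int: ?int
      using distributed_integrable[OF D, of "\<lambda>x. x\<^sup>2"] integrable_normal_moment[OF 1(1), of 0 2] by simp
    have E2: "expectation (\<lambda>\<omega>. (X \<omega>)\<^sup>2) = \<sigma>\<^sup>2"
      using normal_distributed_variance[OF 1(1) D] mean by simp
    \<comment> \<open>After standardization the expected cosine is the real part of the standard
      normal characteristic function at \<sigma>.\<close>
    have "distributed M lborel (\<lambda>x. X x / \<sigma>) std_normal_density"
      using normal_standard_normal_convert[OF 1(1), of X 0] D by simp
    then have Z: "distr M lborel (\<lambda>x. X x / \<sigma>) = std_normal_distribution"
      by (simp add: distributed_def)
    interpret S: prob_space std_normal_distribution by (rule prob_space_normal_density) simp
    have "expectation (\<lambda>\<omega>. cos (X \<omega>)) = (\<integral>x. cos (\<sigma> * x) \<partial>distr M lborel (\<lambda>x. X x / \<sigma>))"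
      using 1(1) by (subst integral_distr) auto
    also have "\<dots> = (\<integral>x. Re (iexp (\<sigma> * x)) \<partial>std_normal_distribution)"
      unfolding Z by (simp add: Re_exp)
    also have "\<dots> = Re (char std_normal_distribution \<sigma>)"
      unfolding char_def by (intro integral_Re S.integrable_const_bound[of _ 1]) auto
    also have "\<dots> = exp (- \<sigma>\<^sup>2 / 2)"
      unfolding char_std_normal_distribution by simp
    finally have ?cos using E2 by simp
    moreover have ?null
    proof -
      have "AE x in lborel. x \<noteq> c" by (rule AE_lborel_singleton)
      then have "AE x in density lborel (normal_density 0 \<sigma>). x \<noteq> c"
        by (subst AE_density) auto
      then have "AE x in distr M lborel X. x \<noteq> c"
        unfolding distributed_distr_eq_density[OF D] .
      then show ?thesis by (subst (asm) AE_distr_iff) auto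
    qed
    ultimately show ?thesis using int by simp
  next
    case 2
    have "expectation X = expectation (\<lambda>_. \<mu>)"
      using 2 by (intro integral_cong_AE) auto
    then have "AE \<omega> in M. X \<omega> = 0"
      using 2 mean by (simp add: prob_space)
    moreover from this have "expectation (\<lambda>\<omega>. (X \<omega>)\<^sup>2) = expectation (\<lambda>_. 0)"
      by (intro integral_cong_AE) auto
    moreover from calculation have "expectation (\<lambda>\<omega>. cos (X \<omega>)) = expectation (\<lambda>_. 1)"
      by (intro integral_cong_AE) auto
    moreover have ?int
      using integrable_cong_AE[of "\<lambda>\<omega>. (X \<omega>)\<^sup>2" M "\<lambda>_. 0"] calculation(1) by auto
    ultimately show ?thesis by (simp add: prob_space)
  qed
  then show ?int ?cos "expectation (\<lambda>\<omega>. (X \<omega>)\<^sup>2) \<noteq> 0 \<Longrightarrow> ?null" by auto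
qed

section \<open>Finite linear forms of a Gaussian process\<close>

lemma finite_support_l2:
  fixes u x :: "nat \<Rightarrow> real"
  shows "(\<lambda>j. if j < m then u j else 0) \<in> l2_space"
    and "l2_inner x (\<lambda>j. if j < m then u j else 0) = (\<Sum>j<m. u j * x j)"
proof -
  show "(\<lambda>j. if j < m then u j else 0) \<in> l2_space"
    unfolding l2_space_def by (auto intro!: summable_finite[of "{..<m}"] split: if_splits)
  show "l2_inner x (\<lambda>j. if j < m then u j else 0) = (\<Sum>j<m. u j * x j)"
    unfolding l2_inner_def by (subst suminf_finite[of "{..<m}"]) (auto simp: mult.commute)
qed

context prob_space
begin

context
  fixes f :: "nat \<Rightarrow> real" and y :: "nat \<Rightarrow> 'a \<Rightarrow> real"
  assumes gp: "gaussian_process M f y"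
begin

lemma gaussian_process_measurable: "random_variable borel (y j)"
  using gp unfolding gaussian_process_def by blast

lemma gaussian_process_l2: "\<omega> \<in> space M \<Longrightarrow> (\<lambda>j. y j \<omega>) \<in> l2_space"
  using gp unfolding gaussian_process_def by blast

lemma gaussian_process_linear_form: "gaussian_rv M (\<lambda>\<omega>. \<Sum>j<m. u j * y j \<omega>)"
proof -
  have "gaussian_rv M (\<lambda>\<omega>. l2_inner (\<lambda>j. y j \<omega>) (\<lambda>j. if j < m then u j else 0))"
    using gp finite_support_l2(1)[where u = u and m = m] unfolding gaussian_process_def by blast
  then show ?thesis by (simp only: finite_support_l2(2))
qed

lemma gaussian_process_coordinate: "gaussian_rv M (y j)" "expectation (y j) = 0"
  "expectation (\<lambda>\<omega>. (y j \<omega>)\<^sup>2) = f j - (f j)\<^sup>2"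
proof -
  have "(\<lambda>\<omega>. \<Sum>i<Suc j. (if i = j then 1 else 0) * y i \<omega>) = y j"
    by (simp add: if_distrib[of "\<lambda>c. c * _"] cong: if_cong)
  then show "gaussian_rv M (y j)"
    using gaussian_process_linear_form[of "\<lambda>i. if i = j then 1 else 0" "Suc j"] by simp
  show "expectation (y j) = 0"
    using gp unfolding gaussian_process_def by blast
  have "expectation (\<lambda>\<omega>. y j \<omega> * y j \<omega>) = (if j = j then f j else 0) - f j * f j"
    using gp unfolding gaussian_process_def by blast
  then show "expectation (\<lambda>\<omega>. (y j \<omega>)\<^sup>2) = f j - (f j)\<^sup>2"
    by (simp add: power2_eq_square)
qed

lemma gaussian_process_square_integrable: "integrable M (\<lambda>\<omega>. (y j \<omega>)\<^sup>2)"
  by (rule gaussian_rv_centered(1)[OF gaussian_process_coordinate(1,2)])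

lemma gaussian_process_integrable: "integrable M (y j)"
  by (rule square_integrable_imp_integrable[OF gaussian_process_measurable gaussian_process_square_integrable])

text \<open>The exponent is minus half the variance of the linear form. It depends continuously on
  finitely many entries of f, and the central limit theorem for the empirical process will produce
  the same expression at p.\<close>

lemma gaussian_process_cos:
  "expectation (\<lambda>\<omega>. cos (\<Sum>j<m. u j * y j \<omega>)) =
     exp (- ((\<Sum>j<m. (u j)\<^sup>2 * f j) - (\<Sum>j<m. u j * f j)\<^sup>2) / 2)"
proof -
  note [measurable] = gaussian_process_measurable
  let ?X = "\<lambda>\<omega>. \<Sum>j<m. u j * y j \<omega>"
  have mean: "expectation ?X = 0"
    by (subst Bochner_Integration.integral_sum)
      (auto simp: gaussian_process_integrable gaussian_process_coordinate)
  have int: "integrable M (\<lambda>\<omega>. y i \<omega> * y j \<omega>)" for i j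
  proof (rule Bochner_Integration.integrable_bound)
    show "integrable M (\<lambda>\<omega>. (y i \<omega>)\<^sup>2 + (y j \<omega>)\<^sup>2)"
      using gaussian_process_square_integrable by simp
    have "\<bar>a * b\<bar> \<le> a\<^sup>2 + b\<^sup>2" for a b :: real
    proof -
      have "2 * \<bar>a * b\<bar> \<le> a\<^sup>2 + b\<^sup>2"
        using sum_squares_bound[of "\<bar>a\<bar>" "\<bar>b\<bar>"] by (simp add: abs_mult)
      then show ?thesis using abs_ge_zero[of "a * b"] by linarith
    qed
    then show "AE \<omega> in M. norm (y i \<omega> * y j \<omega>) \<le> norm ((y i \<omega>)\<^sup>2 + (y j \<omega>)\<^sup>2)"
      by simp
  qed simp
  have cov: "expectation (\<lambda>\<omega>. y i \<omega> * y j \<omega>) = (if i = j then f i else 0) - f i * f j" for i j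
    using gp unfolding gaussian_process_def by blast
  have "expectation (\<lambda>\<omega>. (?X \<omega>)\<^sup>2) = expectation (\<lambda>\<omega>. \<Sum>i<m. \<Sum>j<m. u i * u j * (y i \<omega> * y j \<omega>))"
    by (simp add: power2_eq_square sum_product ac_simps)
  also have "\<dots> = (\<Sum>i<m. \<Sum>j<m. u i * u j * ((if i = j then f i else 0) - f i * f j))"
    by (simp add: Bochner_Integration.integral_sum Bochner_Integration.integrable_sum int cov)
  also have "\<dots> = (\<Sum>i<m. \<Sum>j<m. (if i = j then u i * u j * f i else 0)) - (\<Sum>i<m. \<Sum>j<m. (u i * f i) * (u j * f j))"
    unfolding sum_subtractf[symmetric]
    by (intro sum.cong refl) (simp add: right_diff_distrib ac_simps)
  also have "\<dots> = (\<Sum>j<m. (u j)\<^sup>2 * f j) - (\<Sum>j<m. u j * f j)\<^sup>2"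
    by (simp add: power2_eq_square sum_product)
  finally show ?thesis
    using gaussian_rv_centered(2)[OF gaussian_process_linear_form mean] by simp
qed

end

end

text \<open>The squares tend to 0, so only finitely many coordinates compete with a given nonzero
  one.\<close>

lemma l2_sup_attained:
  assumes "f \<in> l2_space"
  shows "\<exists>i. (\<forall>j. \<bar>f j\<bar> \<le> \<bar>f i\<bar>) \<and> lnorm \<infinity> f = \<bar>f i\<bar>"
proof -
  have "\<exists>i. \<forall>j. \<bar>f j\<bar> \<le> \<bar>f i\<bar>"
  proof (cases "\<forall>i. f i = 0")
    case False
    then obtain i where i: "0 < (f i)\<^sup>2" by auto
    have "(\<lambda>j. (f j)\<^sup>2) \<longlonglongrightarrow> 0"
      using assms summable_LIMSEQ_zero[of "\<lambda>j. (f j)\<^sup>2"]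
      by (simp only: l2_space_def mem_Collect_eq)
    from order_tendstoD(2)[OF this i] obtain n where n: "\<And>j. j \<ge> n \<Longrightarrow> (f j)\<^sup>2 < (f i)\<^sup>2"
      by (auto simp: eventually_sequentially)
    \<comment> \<open>Including i itself in the range makes the maximum dominate
      \<open>(f i)\<^sup>2\<close>, and thereby every coordinate beyond n.\<close>
    have "Max ((\<lambda>j. (f j)\<^sup>2) ` {..max n i}) \<in> (\<lambda>j. (f j)\<^sup>2) ` {..max n i}"
      by (intro Max_in) auto
    then obtain k where "Max ((\<lambda>j. (f j)\<^sup>2) ` {..max n i}) = (f k)\<^sup>2"
      by blast
    then have k: "(f j)\<^sup>2 \<le> (f k)\<^sup>2" if "j \<le> max n i" for j
      using that Max_ge[of "(\<lambda>j. (f j)\<^sup>2) ` {..max n i}" "(f j)\<^sup>2"] by simp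
    have "(f j)\<^sup>2 \<le> (f k)\<^sup>2" for j
      using k[of j] k[of i] n[of j] by (cases "j \<le> max n i") (simp, linarith)
    then show ?thesis by (auto simp: abs_le_square_iff)
  qed auto
  then obtain i where i: "\<And>j. \<bar>f j\<bar> \<le> \<bar>f i\<bar>" by blast
  then have "(SUP j. \<bar>f j\<bar>) = \<bar>f i\<bar>"
    by (intro cSup_eq_maximum) auto
  with i show ?thesis by (auto simp: lnorm_def)
qed

lemma l2_sup_le_iff:
  assumes "f \<in> l2_space"
  shows "lnorm \<infinity> f \<le> t \<longleftrightarrow> (\<forall>j. \<bar>f j\<bar> \<le> t)"
proof -
  obtain i where "\<And>j. \<bar>f j\<bar> \<le> \<bar>f i\<bar>" "lnorm \<infinity> f = \<bar>f i\<bar>"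
    using l2_sup_attained[OF assms] by blast
  then show ?thesis by (auto intro: order_trans)
qed

lemma (in prob_space) gaussian_sup_norm_measurable:
  assumes gp: "gaussian_process M f y"
  shows "random_variable borel (\<lambda>\<omega>. lnorm \<infinity> (\<lambda>j. y j \<omega>))"
proof (rule borel_measurableI_le)
  note [measurable] = gaussian_process_measurable[OF gp]
  fix t
  have "{\<omega> \<in> space M. lnorm \<infinity> (\<lambda>j. y j \<omega>) \<le> t} = {\<omega> \<in> space M. \<forall>j. \<bar>y j \<omega>\<bar> \<le> t}"
    using l2_sup_le_iff[OF gaussian_process_l2[OF gp]] by auto
  also have "\<dots> \<in> events" by measurable
  finally show "{\<omega> \<in> space M. lnorm \<infinity> (\<lambda>j. y j \<omega>) \<le> t} \<in> events" .
qed

lemma (in prob_space) gaussian_sup_cdf: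
  assumes gp: "gaussian_process M f y"
  shows "prob {\<omega> \<in> space M. \<forall>j. \<bar>y j \<omega>\<bar> \<le> t} = cdf (distr M borel (\<lambda>\<omega>. lnorm \<infinity> (\<lambda>j. y j \<omega>))) t"
proof -
  have "{\<omega> \<in> space M. \<forall>j. \<bar>y j \<omega>\<bar> \<le> t} = (\<lambda>\<omega>. lnorm \<infinity> (\<lambda>j. y j \<omega>)) -` {..t} \<inter> space M"
    using l2_sup_le_iff[OF gaussian_process_l2[OF gp]] by auto
  then show ?thesis
    unfolding cdf_def by (subst measure_distr[OF gaussian_sup_norm_measurable[OF gp]]) simp_all
qed

lemma (in prob_space) gaussian_sup_tail:
  assumes gp: "gaussian_process M f y"
  shows "prob {\<omega> \<in> space M. lnorm \<infinity> (\<lambda>j. y j \<omega>) > t} = 1 - prob {\<omega> \<in> space M. \<forall>j. \<bar>y j \<omega>\<bar> \<le> t}"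
proof -
  note [measurable] = gaussian_process_measurable[OF gp]
  have "{\<omega> \<in> space M. lnorm \<infinity> (\<lambda>j. y j \<omega>) > t} = space M - {\<omega> \<in> space M. \<forall>j. \<bar>y j \<omega>\<bar> \<le> t}"
    using l2_sup_le_iff[OF gaussian_process_l2[OF gp]] by (auto simp: not_le[symmetric] simp del: not_le)
  then show ?thesis
    by (simp add: prob_compl)
qed

text \<open>The supremum is attained, so the law of the norm can only charge points charged by the law of
  a coordinate.\<close>

lemma (in prob_space) gaussian_sup_cdf_continuous:
  assumes gp: "gaussian_process M f y" and j0: "0 < f j0" "f j0 < 1"
  shows "isCont (\<lambda>t. prob {\<omega> \<in> space M. \<forall>j. \<bar>y j \<omega>\<bar> \<le> t}) t"
proof -
  note [measurable] = gaussian_process_measurable[OF gp]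
  let ?Z = "\<lambda>\<omega>. lnorm \<infinity> (\<lambda>j. y j \<omega>)"
  note Z[measurable] = gaussian_sup_norm_measurable[OF gp]
  interpret D: real_distribution "distr M borel ?Z"
    by (rule real_distribution_distr) (rule Z)
  note c = gaussian_rv_centered[OF gaussian_process_coordinate(1,2)[OF gp], unfolded gaussian_process_coordinate(3)[OF gp]]
  have nondeg: "AE \<omega> in M. \<bar>y j \<omega>\<bar> \<noteq> t" if "f j - (f j)\<^sup>2 \<noteq> 0" for j
    using c(3)[OF that, of t] c(3)[OF that, of "- t"] by eventually_elim auto
  have deg: "AE \<omega> in M. y j \<omega> = 0" if "f j - (f j)\<^sup>2 = 0" for j
    using integral_nonneg_eq_0_iff_AE[OF c(1)[of j]] gaussian_process_coordinate(3)[OF gp, of j] that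
    by simp
  have nd0: "f j0 - (f j0)\<^sup>2 \<noteq> 0"
    using j0 by (simp add: power2_eq_square)
  have ae: "AE \<omega> in M. \<forall>j. (f j - (f j)\<^sup>2 \<noteq> 0 \<longrightarrow> \<bar>y j \<omega>\<bar> \<noteq> t) \<and> (f j - (f j)\<^sup>2 = 0 \<longrightarrow> y j \<omega> = 0)"
    unfolding AE_all_countable using nondeg deg by auto
  have key: "?Z \<omega> \<noteq> t" if \<omega>: "\<omega> \<in> space M"
    and *: "\<forall>j. (f j - (f j)\<^sup>2 \<noteq> 0 \<longrightarrow> \<bar>y j \<omega>\<bar> \<noteq> t) \<and> (f j - (f j)\<^sup>2 = 0 \<longrightarrow> y j \<omega> = 0)" for \<omega>
  proof
    assume Zt: "?Z \<omega> = t"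
    have "(\<lambda>j. y j \<omega>) \<in> l2_space" by (rule gaussian_process_l2[OF gp \<omega>])
    from l2_sup_attained[OF this] Zt obtain i where i: "\<forall>j. \<bar>y j \<omega>\<bar> \<le> t" "\<bar>y i \<omega>\<bar> = t"
      by auto
    \<comment> \<open>The supremum is attained at i, and a nondegenerate coordinate avoids t, so
      coordinate i is degenerate and t is its value 0. Then the nondegenerate coordinate
      \<open>j0\<close> would have absolute value 0 = t as well, which has been excluded.\<close>
    have "t = 0" using *[rule_format, of i] i(2) by auto
    then have "\<bar>y j0 \<omega>\<bar> = t" using i(1)[rule_format, of j0] by simp
    then show False using *[rule_format, of j0] nd0 by blast
  qed
  have "AE \<omega> in M. ?Z \<omega> \<noteq> t"
    using AE_space ae by eventually_elim (rule key)
  then have "prob {\<omega> \<in> space M. ?Z \<omega> = t} = 0"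
    by (subst prob_eq_0) auto
  then have "measure (distr M borel ?Z) {t} = 0"
    by (subst measure_distr) (auto simp: vimage_def Int_def conj_commute)
  then have "isCont (cdf (distr M borel ?Z)) t"
    by (rule D.isCont_cdf[THEN iffD2])
  then show ?thesis
    by (simp only: gaussian_sup_cdf[OF gp])
qed

text \<open>A continuous distribution function takes the value 1 - \<alpha>, so the defining
  equation of the quantile is solvable and the default 0 does not occur.\<close>

lemma (in prob_space) gaussian_sup_quantile:
  assumes gp: "gaussian_process M f y" and j0: "0 < f j0" "f j0 < 1" and \<alpha>: "0 < \<alpha>" "\<alpha> < 1"
  shows "prob {\<omega> \<in> space M. \<forall>j. \<bar>y j \<omega>\<bar> \<le> sup_quantile M y \<alpha>} = 1 - \<alpha>"
proof -
  let ?F = "\<lambda>t. prob {\<omega> \<in> space M. \<forall>j. \<bar>y j \<omega>\<bar> \<le> t}"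
  interpret D: real_distribution "distr M borel (\<lambda>\<omega>. lnorm \<infinity> (\<lambda>j. y j \<omega>))"
    by (rule real_distribution_distr) (rule gaussian_sup_norm_measurable[OF gp])
  have Feq: "?F = cdf (distr M borel (\<lambda>\<omega>. lnorm \<infinity> (\<lambda>j. y j \<omega>)))"
    by (rule ext) (rule gaussian_sup_cdf[OF gp])
  define F where "F = ?F"
  have F: "F = cdf (distr M borel (\<lambda>\<omega>. lnorm \<infinity> (\<lambda>j. y j \<omega>)))"
    unfolding F_def by (rule Feq)
  have "\<forall>\<^sub>F t in at_bot. F t < 1 - \<alpha>"
    using \<alpha> unfolding F by (intro order_tendstoD(2)[OF D.cdf_lim_at_bot]) simp
  moreover have "\<forall>\<^sub>F t in at_top. 1 - \<alpha> < F t"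
    using \<alpha> unfolding F by (intro order_tendstoD(1)[OF D.cdf_lim_at_top_prob]) simp
  ultimately obtain a b where ab: "\<forall>t\<le>a. F t < 1 - \<alpha>" "\<forall>t\<ge>b. 1 - \<alpha> < F t"
    unfolding eventually_at_bot_linorder eventually_at_top_linorder by blast
  \<comment> \<open>The two limits give a and b without an ordering, hence the minimum and
    maximum.\<close>
  have "\<exists>t\<ge>min a b. t \<le> max a b \<and> F t = 1 - \<alpha>"
  proof (rule IVT)
    show "F (min a b) \<le> 1 - \<alpha>" "1 - \<alpha> \<le> F (max a b)"
      using ab(1)[rule_format, of "min a b"] ab(2)[rule_format, of "max a b"] by simp_all
    show "\<forall>t. min a b \<le> t \<and> t \<le> max a b \<longrightarrow> isCont F t"
      using gaussian_sup_cdf_continuous[OF gp j0] unfolding F_def by blast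
  qed simp
  then obtain t where "F t = 1 - \<alpha>" by blast
  then have "\<exists>t. 1 - ?F t = \<alpha>" by (intro exI[of _ t]) (simp add: F_def)
  then have "1 - ?F (sup_quantile M y \<alpha>) = \<alpha>"
    unfolding sup_quantile_def gaussian_sup_tail[OF gp] Let_def
    by (simp only: if_True) (rule someI_ex)
  then show ?thesis by simp
qed

section \<open>Stability in the parameter of the Gaussian process\<close>

lemma prob_vectorsD:
  assumes "f \<in> prob_vectors J"
  shows "0 \<le> f j" "f sums 1" "f j \<le> 1"
proof -
  show f: "0 \<le> f j" "f sums 1" for j
    using assms by (auto simp: prob_vectors_def)
  then show "f j \<le> 1"
    using sum_le_suminf[of f "{j}"] by (auto simp: sums_iff)
qed

text \<open>The convergence criterion speaks of sequences, whereas a data-dependent f needs a full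
  neighbourhood of p. A counterexample at every radius 1 / (k + 1) would give a sequence
  contradicting the criterion.\<close>

lemma (in prob_space) gaussian_sup_cdf_stable:
  assumes gauss: "\<And>f. f \<in> prob_vectors J \<Longrightarrow> gaussian_process M f (Y f)"
    and p: "p \<in> prob_vectors J" and j0: "0 < p j0" "p j0 < 1" and e: "0 < e"
  shows "\<exists>\<delta>>0. \<forall>f\<in>prob_vectors J. (\<forall>j. \<bar>f j - p j\<bar> < \<delta>) \<longrightarrow>
    \<bar>prob {\<omega> \<in> space M. \<forall>j. \<bar>Y f j \<omega>\<bar> \<le> t} - prob {\<omega> \<in> space M. \<forall>j. \<bar>Y p j \<omega>\<bar> \<le> t}\<bar> < e"
proof (rule ccontr)
  let ?F = "\<lambda>f. prob {\<omega> \<in> space M. \<forall>j. \<bar>Y f j \<omega>\<bar> \<le> t}"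
  define far where "far \<delta> f \<longleftrightarrow> f \<in> prob_vectors J \<and> (\<forall>j. \<bar>f j - p j\<bar> < \<delta>) \<and> e \<le> \<bar>?F f - ?F p\<bar>" for \<delta> f
  assume "\<not> ?thesis"
  then have "\<exists>f. far \<delta> f" if "0 < \<delta>" for \<delta>
    unfolding far_def not_ex not_all not_imp bex_simps ball_simps not_less de_Morgan_conj
    using that by (meson not_le)
  then have "\<exists>f. far (1 / real (Suc k)) f" for k
    by simp
  then obtain f where "\<And>k. far (1 / real (Suc k)) (f k)"
    by metis
  then have f: "\<And>k. f k \<in> prob_vectors J" "\<And>k j. \<bar>f k j - p j\<bar> < 1 / real (Suc k)"
    "\<And>k. e \<le> \<bar>?F (f k) - ?F p\<bar>"
    unfolding far_def by blast+
  have lim: "(\<lambda>k. f k j) \<longlonglongrightarrow> p j" for j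
  proof (rule Lim_null[THEN iffD2], rule tendsto_rabs_zero_cancel,
      rule tendsto_sandwich[of "\<lambda>_. 0" _ _ "\<lambda>k. 1 / real (Suc k)"])
    show "(\<lambda>k. 1 / real (Suc k)) \<longlonglongrightarrow> 0" by (rule LIMSEQ_Suc) (rule lim_1_over_n)
    show "\<forall>\<^sub>F k in sequentially. \<bar>f k j - p j\<bar> \<le> 1 / real (Suc k)"
      using f(2) by (intro always_eventually) (auto intro: less_imp_le)
  qed auto
  note gf = gauss[OF f(1)] and gp = gauss[OF p]
  \<comment> \<open>The variance f_j - f_j^2 is at most f_j, so f itself supplies the weights of
    total mass 1.\<close>
  have sq_le: "expectation (\<lambda>\<omega>. (Y h j \<omega>)\<^sup>2) \<le> h j" if "h \<in> prob_vectors J" for h j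
    using gaussian_process_coordinate(3)[OF gauss[OF that], of j] by simp
  have "(\<lambda>k. ?F (f k)) \<longlonglongrightarrow> ?F p"
  proof (rule sup_norm_cdf_tendsto[where v = f and w = p])
    show "isCont (\<lambda>t. prob {\<omega> \<in> space M. \<forall>j. \<bar>Y p j \<omega>\<bar> \<le> t}) t"
      by (rule gaussian_sup_cdf_continuous[OF gp j0])
    show "(\<lambda>k. expectation (\<lambda>\<omega>. cos (\<Sum>j<m. u j * Y (f k) j \<omega>)))
        \<longlonglongrightarrow> expectation (\<lambda>\<omega>. cos (\<Sum>j<m. u j * Y p j \<omega>))" for m u
      unfolding gaussian_process_cos[OF gf] gaussian_process_cos[OF gp]
      by (intro tendsto_intros lim) simp
  qed (use f(1) p lim sq_le prob_vectorsD gaussian_process_measurable[OF gf] gaussian_process_measurable[OF gp]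
      gaussian_process_square_integrable[OF gf] gaussian_process_square_integrable[OF gp] prob_space_axioms in blast)+
  from tendstoD[OF this e] obtain k where "\<bar>?F (f k) - ?F p\<bar> < e"
    unfolding dist_real_def eventually_sequentially by blast
  with f(3)[of k] show False by simp
qed

text \<open>Stability of the distribution function is used only at the two points a and b: near p
  the strict inequalities persist for f, and monotonicity then places the quantile of f between a
  and b.\<close>

lemma (in prob_space) gaussian_sup_quantile_stable:
  assumes gauss: "\<And>f. f \<in> prob_vectors J \<Longrightarrow> gaussian_process M f (Y f)"
    and p: "p \<in> prob_vectors J" and j0: "0 < p j0" "p j0 < 1" and \<alpha>: "0 < \<alpha>" "\<alpha> < 1"
    and a: "prob {\<omega> \<in> space M. \<forall>j. \<bar>Y p j \<omega>\<bar> \<le> a} < 1 - \<alpha>"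
    and b: "1 - \<alpha> < prob {\<omega> \<in> space M. \<forall>j. \<bar>Y p j \<omega>\<bar> \<le> b}"
  shows "\<exists>\<delta>>0. \<forall>f\<in>prob_vectors J. (\<forall>j. \<bar>f j - p j\<bar> < \<delta>) \<longrightarrow>
    a < sup_quantile M (Y f) \<alpha> \<and> sup_quantile M (Y f) \<alpha> < b"
proof -
  let ?F = "\<lambda>f t. prob {\<omega> \<in> space M. \<forall>j. \<bar>Y f j \<omega>\<bar> \<le> t}"
  obtain d1 where d1: "0 < d1" "\<And>f. f \<in> prob_vectors J \<Longrightarrow> (\<And>j. \<bar>f j - p j\<bar> < d1) \<Longrightarrow>
      \<bar>?F f a - ?F p a\<bar> < 1 - \<alpha> - ?F p a"
    using gaussian_sup_cdf_stable[OF gauss p j0, of "1 - \<alpha> - ?F p a" a] a by auto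
  obtain d2 where d2: "0 < d2" "\<And>f. f \<in> prob_vectors J \<Longrightarrow> (\<And>j. \<bar>f j - p j\<bar> < d2) \<Longrightarrow>
      \<bar>?F f b - ?F p b\<bar> < ?F p b - (1 - \<alpha>)"
    using gaussian_sup_cdf_stable[OF gauss p j0, of "?F p b - (1 - \<alpha>)" b] b by auto
  \<comment> \<open>The last two terms keep \<open>f j0\<close> strictly between 0 and 1, so that
    the quantile of f solves its defining equation.\<close>
  define d where "d = min (min d1 d2) (min (p j0) (1 - p j0))"
  have "a < sup_quantile M (Y f) \<alpha> \<and> sup_quantile M (Y f) \<alpha> < b"
    if f: "f \<in> prob_vectors J" and near: "\<forall>j. \<bar>f j - p j\<bar> < d" for f
  proof -
    note [measurable] = gaussian_process_measurable[OF gauss[OF f]]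
    have "0 < f j0" "f j0 < 1"
      using near[rule_format, of j0] by (auto simp: d_def abs_less_iff)
    note q = gaussian_sup_quantile[OF gauss[OF f] this \<alpha>]
    have mono: "?F f t \<le> ?F f t'" if "t \<le> t'" for t t'
      using that by (intro finite_measure_mono) (auto intro: order_trans)
    have "\<bar>?F f a - ?F p a\<bar> < 1 - \<alpha> - ?F p a" "\<bar>?F f b - ?F p b\<bar> < ?F p b - (1 - \<alpha>)"
      using near by (auto intro!: d1(2) d2(2) f simp: d_def)
    then have "?F f a < 1 - \<alpha>" "1 - \<alpha> < ?F f b" by linarith+
    then show ?thesis
      using mono[of "sup_quantile M (Y f) \<alpha>" a] mono[of b "sup_quantile M (Y f) \<alpha>"] q by linarith
  qed
  moreover have "0 < d" using d1 d2 j0 by (simp add: d_def)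
  ultimately show ?thesis by blast
qed

subsection \<open>The mixture parameter\<close>

lemma lnorm_inf_le:
  assumes "\<And>j. \<bar>f j\<bar> \<le> c"
  shows "lnorm \<infinity> f \<le> c"
  using assms by (auto simp: lnorm_def intro!: cSUP_least)

lemma abs_le_lnorm_inf:
  assumes "\<And>j. \<bar>f j\<bar> \<le> c"
  shows "\<bar>f j\<bar> \<le> lnorm \<infinity> f"
proof -
  have "bdd_above (range (\<lambda>j. \<bar>f j\<bar>))"
    using assms by (intro bdd_aboveI[of _ c]) auto
  then show ?thesis
    unfolding lnorm_def by (auto intro: cSUP_upper)
qed

lemma prob_vectors_diff_le_1:
  assumes "f \<in> prob_vectors J" "h \<in> prob_vectors J"
  shows "\<bar>f j - h j\<bar> \<le> 1"
  using prob_vectorsD(1,3)[OF assms(1), of j] prob_vectorsD(1,3)[OF assms(2), of j] by simp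

lemma summable_prob_mult:
  assumes "f \<in> prob_vectors J" "h \<in> prob_vectors J"
  shows "summable (\<lambda>j. f j * h j)"
proof (rule summable_comparison_test')
  show "summable f" using prob_vectorsD(2)[OF assms(1)] by (rule sums_summable)
  show "norm (f j * h j) \<le> f j" for j
    using prob_vectorsD(1,3)[OF assms(1), of j] prob_vectorsD(1,3)[OF assms(2), of j]
    by (simp add: mult_left_le)
qed

text \<open>Equal total mass: a probability vector dominating another one coincides with it. For
  \<open>h = \<Psi> p\<close> this yields a coordinate in which the map loses mass.\<close>

lemma prob_vectors_exists_less:
  assumes p: "p \<in> prob_vectors J" and h: "h \<in> prob_vectors J" and ne: "h \<noteq> p"
  shows "\<exists>k. h k < p k"
proof (rule ccontr)
  assume "\<not> ?thesis"
  then have le: "0 \<le> h k - p k" for k by (simp add: not_less)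
  have "(\<lambda>k. h k - p k) sums (1 - 1)"
    using prob_vectorsD(2)[OF h] prob_vectorsD(2)[OF p] by (rule sums_diff)
  then have "h k - p k = 0" for k
    using le suminf_eq_zero_iff[of "\<lambda>k. h k - p k"] by (simp add: sums_iff)
  then show False using ne by auto
qed

section \<open>Frequency data and leave-one-out vectors\<close>

context
  fixes J :: "nat set" and n :: nat and x :: "nat \<Rightarrow> nat"
  assumes x: "freq_data J n x"
begin

lemma freq_data_le_t_max: "0 < x j \<Longrightarrow> j \<le> t_max x"
  using x unfolding freq_data_def t_max_def by (intro le_cSup_finite) auto

lemma freq_data_sum_t_max: "(\<Sum>j\<le>t_max x. real (x j)) = real n"
proof -
  have "(\<Sum>j | x j > 0. real (x j)) = (\<Sum>j\<le>t_max x. real (x j))"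
    using freq_data_le_t_max by (intro sum.mono_neutral_left) auto
  moreover have "(\<Sum>j | x j > 0. real (x j)) = real n"
    using x unfolding freq_data_def by (simp flip: of_nat_sum)
  ultimately show ?thesis by simp
qed

lemma freq_data_le: "x j \<le> n"
proof (cases "x j = 0")
  case False
  then show ?thesis
    using x member_le_sum[of j "{j. x j > 0}" x] by (auto simp: freq_data_def)
qed simp

lemma freq_data_sums: "(\<lambda>j. real (x j) * c j) sums (\<Sum>j\<le>t_max x. real (x j) * c j)"
proof (rule sums_finite)
  show "real (x j) * c j = 0" if "j \<notin> {..t_max x}" for j
    using freq_data_le_t_max[of j] that by (cases "x j = 0") auto
qed simp

lemma emp_prob_vectors:
  assumes "n \<ge> 1"
  shows "emp n x \<in> prob_vectors J"
proof -
  have "emp n x sums ((\<Sum>j\<le>t_max x. real (x j) * 1) / real n)"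
    unfolding emp_def using sums_divide[OF freq_data_sums[of "\<lambda>_. 1"]] by simp
  moreover have "x j = 0" if "j \<notin> J" for j
    using x that by (auto simp: freq_data_def)
  ultimately show ?thesis
    using assms freq_data_sum_t_max by (simp add: prob_vectors_def emp_def)
qed

lemma emp_loo_prob_vectors:
  assumes "n \<ge> 2" "0 < x i"
  shows "emp_loo n x i \<in> prob_vectors J"
proof -
  have "(\<lambda>j. real (x j) - (if j = i then 1 else 0)) sums (real n - 1)"
    using freq_data_sums[of "\<lambda>_. 1"] sums_single[of i "\<lambda>_. 1 :: real"] freq_data_sum_t_max
    by (intro sums_diff) auto
  then have "emp_loo n x i sums ((real n - 1) / (real n - 1))"
    unfolding emp_loo_def by (rule sums_divide)
  moreover have "x j = 0" if "j \<notin> J" for j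
    using x that by (auto simp: freq_data_def)
  moreover have "i \<in> J"
    using x assms(2) by (auto simp: freq_data_def)
  ultimately show ?thesis
    using assms by (auto simp: prob_vectors_def emp_loo_def)
qed

lemma emp_loo_near_emp:
  assumes "n \<ge> 2" "0 < x i"
  shows "\<bar>emp_loo n x i k - emp n x k\<bar> \<le> 1 / (real n - 1)"
proof -
  have "emp_loo n x i k - emp n x k = (real (x k) / real n - (if k = i then 1 else 0)) / (real n - 1)"
    using assms(1) by (auto simp: emp_loo_def emp_def field_simps)
  moreover have "\<bar>real (x k) / real n - (if k = i then 1 else 0)\<bar> \<le> 1"
    using freq_data_le[of k] assms(1) by (auto simp: abs_le_iff divide_simps)
  ultimately show ?thesis
    using assms(1) divide_right_mono[of _ 1 "real n - 1"] by (simp only: abs_divide) auto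
qed

lemma emp_loo_near_emp_loo:
  assumes "n \<ge> 2"
  shows "\<bar>emp_loo n x i k - emp_loo n x j k\<bar> \<le> 1 / (real n - 1)"
  using assms by (auto simp: emp_loo_def diff_divide_distrib[symmetric] abs_divide)

end

lemma linf_contractionD:
  assumes "linf_contraction J \<Psi>" "\<forall>f\<in>prob_vectors J. \<Psi> f \<in> prob_vectors J"
    and f: "f \<in> prob_vectors J" and h: "h \<in> prob_vectors J" and le: "\<And>j. \<bar>f j - h j\<bar> \<le> c"
  shows "\<bar>\<Psi> f k - \<Psi> h k\<bar> \<le> c"
proof -
  have "\<bar>\<Psi> f k - \<Psi> h k\<bar> \<le> lnorm \<infinity> (\<lambda>j. \<Psi> f j - \<Psi> h j)"
    using assms(2) f h by (intro abs_le_lnorm_inf[of _ 1] prob_vectors_diff_le_1) auto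
  also have "\<dots> \<le> lnorm \<infinity> (\<lambda>j. f j - h j)"
    using assms(1) f h by (simp add: linf_contraction_def)
  also have "\<dots> \<le> c"
    by (rule lnorm_inf_le[OF le])
  finally show ?thesis .
qed

lemma mixture_beta_range: "0 \<le> mixture_beta d \<Psi> n x" "mixture_beta d \<Psi> n x \<le> 1"
  by (auto simp: mixture_beta_def beta_L1_def beta_L2_def divide_simps)

section \<open>Bounds for the two cross-validation rules\<close>

context
  fixes J :: "nat set" and \<Psi> :: "(nat \<Rightarrow> real) \<Rightarrow> nat \<Rightarrow> real"
  assumes maps: "\<forall>f\<in>prob_vectors J. \<Psi> f \<in> prob_vectors J"
    and contr: "linf_contraction J \<Psi>"
begin

context
  fixes n :: nat and x :: "nat \<Rightarrow> nat"
  assumes x: "freq_data J n x" and n: "n \<ge> 2"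
begin

lemma g_loo_nonneg: "0 \<le> g_loo \<Psi> n x i k"
  using maps prob_vectorsD(1)[of "\<Psi> (emp_loo n x i)" J k] emp_loo_prob_vectors[OF x n, of i]
  by (auto simp: g_loo_def)

lemma map_emp_prob_vectors: "\<Psi> (emp n x) \<in> prob_vectors J"
  using maps emp_prob_vectors[OF x] n by simp

text \<open>Leaving out one observation moves the empirical vector by at most 1 / (n - 1) in
  sup-norm, and the contraction property passes this on to the images. The factor n - 1 is the one
  that occurs in both rules.\<close>

lemma g_loo_near_emp:
  assumes "0 < x i"
  shows "(real n - 1) * (g_loo \<Psi> n x i k - \<Psi> (emp n x) k) \<le> 1"
proof -
  have "\<bar>\<Psi> (emp_loo n x i) k - \<Psi> (emp n x) k\<bar> \<le> 1 / (real n - 1)"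
    using n by (intro linf_contractionD[OF contr maps] emp_loo_prob_vectors[OF x n assms]
        emp_prob_vectors[OF x] emp_loo_near_emp[OF x n assms]) simp
  from abs_le_D1[OF this] show ?thesis
    using assms n by (simp add: g_loo_def pos_le_divide_eq mult.commute)
qed

lemma g_loo_near_g_loo:
  assumes "0 < x i" "0 < x j"
  shows "(real n - 1) * (g_loo \<Psi> n x i k - g_loo \<Psi> n x j k) \<le> 1"
proof -
  have "\<bar>\<Psi> (emp_loo n x i) k - \<Psi> (emp_loo n x j) k\<bar> \<le> 1 / (real n - 1)"
    by (intro linf_contractionD[OF contr maps] emp_loo_prob_vectors[OF x n]
        assms emp_loo_near_emp_loo[OF x n])
  from abs_le_D1[OF this] show ?thesis
    using assms n by (simp add: g_loo_def pos_le_divide_eq mult.commute)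
qed

text \<open>The criterion is n^2 times the empirical residual, up to the effect of leaving one
  observation out. That effect is at most 1 per observation, n in total, so a residual of 2 / n
  still leaves the required n.\<close>

lemma beta_L1_eq_0:
  assumes "2 / real n \<le> l2_inner (emp n x) (\<lambda>j. emp n x j - \<Psi> (emp n x) j)"
  shows "beta_L1 \<Psi> n x = 0"
proof -
  define g where "g j = g_loo \<Psi> n x j j" for j
  \<comment> \<open>The terms in g^2 cancel: n^2 - n(n + 1) + n = 0.\<close>
  have summand: "(real (x j) - real n * g j)\<^sup>2 + (real n + 1) * g j * (real (x j) - real n * g j) + real n * (g j)\<^sup>2
      = real (x j) * (real (x j) - (real n - 1) * g j)" for j
    by (simp add: power2_eq_square algebra_simps)
  let ?D = "l2_inner (emp n x) (\<lambda>j. emp n x j - \<Psi> (emp n x) j)"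
  have "?D = (\<Sum>j. real (x j) * ((emp n x j - \<Psi> (emp n x) j) / real n))"
    by (simp add: l2_inner_def emp_def)
  also have "\<dots> = (\<Sum>j\<le>t_max x. real (x j) * ((emp n x j - \<Psi> (emp n x) j) / real n))"
    by (rule sums_unique[OF freq_data_sums[OF x], symmetric])
  finally have D: "?D = (\<Sum>j\<le>t_max x. real (x j) * ((emp n x j - \<Psi> (emp n x) j) / real n))" .
  have "real n * real n * ?D = (\<Sum>j\<le>t_max x. real (x j) * (real (x j) - real n * \<Psi> (emp n x) j))"
    unfolding D sum_distrib_left
    using n by (intro sum.cong refl) (simp add: emp_def field_simps)
  also have "\<dots> \<le> (\<Sum>j\<le>t_max x. real (x j) * (real (x j) - (real n - 1) * g j) + real (x j))"
  proof (intro sum_mono)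
    fix j
    show "real (x j) * (real (x j) - real n * \<Psi> (emp n x) j)
        \<le> real (x j) * (real (x j) - (real n - 1) * g j) + real (x j)"
    proof (cases "x j = 0")
      case False
      then have "(real n - 1) * (g j - \<Psi> (emp n x) j) \<le> 1"
        using g_loo_near_emp[of j j] unfolding g_def by simp
      moreover have "0 \<le> \<Psi> (emp n x) j"
        by (rule prob_vectorsD(1)[OF map_emp_prob_vectors])
      \<comment> \<open>Passing from n to n - 1 in front of \<open>\<Psi> (emp n x) j\<close> goes
        in the right direction because that entry is nonnegative.\<close>
      ultimately have "real (x j) - real n * \<Psi> (emp n x) j \<le> (real (x j) - (real n - 1) * g j) + 1"
        by (simp add: algebra_simps)
      from mult_left_mono[OF this, of "real (x j)"] show ?thesis
        by (simp add: algebra_simps)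
    qed simp
  qed
  also have "\<dots> = (\<Sum>j\<le>t_max x. real (x j) * (real (x j) - (real n - 1) * g j)) + real n"
    by (simp add: sum.distrib freq_data_sum_t_max[OF x])
  finally have "real n * real n * ?D - real n
      \<le> (\<Sum>j\<le>t_max x. real (x j) * (real (x j) - (real n - 1) * g j))" by simp
  moreover have "2 * real n \<le> real n * real n * ?D"
    using mult_left_mono[OF assms, of "real n * real n"] n by simp
  ultimately have "real n \<le> (\<Sum>j\<le>t_max x. real (x j) * (real (x j) - (real n - 1) * g j))" by simp
  then show ?thesis
    unfolding beta_L1_def g_def[symmetric] summand by simp
qed

text \<open>Only differences of two leave-one-out estimates at the same coordinate enter, and n - 1
  times such a difference is at most 1. The double sum is thus at most n^2 instead of being of order
  n^3.\<close>

lemma b_L2_le: "b_L2 \<Psi> n x \<le> 2 * (real n)\<^sup>2"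
proof -
  have "(real n - 1) * (\<Sum>j\<le>t_max x. real (x j) * (\<Sum>k\<le>t_max x. real (x k) * (g_loo \<Psi> n x k k - g_loo \<Psi> n x j k)))
      = (\<Sum>j\<le>t_max x. \<Sum>k\<le>t_max x. real (x j) * (real (x k) * ((real n - 1) * (g_loo \<Psi> n x k k - g_loo \<Psi> n x j k))))"
    by (simp add: sum_distrib_left ac_simps)
  also have "\<dots> \<le> (\<Sum>j\<le>t_max x. \<Sum>k\<le>t_max x. real (x j) * (real (x k) * 1))"
  proof (intro sum_mono)
    fix j k
    show "real (x j) * (real (x k) * ((real n - 1) * (g_loo \<Psi> n x k k - g_loo \<Psi> n x j k)))
        \<le> real (x j) * (real (x k) * 1)"
    proof (cases "x j = 0 \<or> x k = 0")
      case False
      then have "(real n - 1) * (g_loo \<Psi> n x k k - g_loo \<Psi> n x j k) \<le> 1"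
        using g_loo_near_g_loo[of k j k] by simp
      then show ?thesis
        by (intro mult_left_mono) auto
    qed auto
  qed
  also have "\<dots> = (real n)\<^sup>2"
    by (simp add: sum_distrib_left[symmetric] sum_distrib_right[symmetric] freq_data_sum_t_max[OF x] power2_eq_square)
  finally show ?thesis
    unfolding b_L2_def using sum_nonneg[of "{..t_max x}" "\<lambda>j. (real (x j))\<^sup>2"] by simp
qed

text \<open>A single coordinate with gap c makes each inner sum of squares of order n^2, and the
  weights \<open>x j\<close> add up to n. This gives the cubic term, while the linear terms
  contribute at most 2n^2.\<close>

lemma a_L2_ge:
  assumes gap: "0 < c" "c \<le> emp n x k - \<Psi> (emp n x) k" "2 \<le> real n * c"
  shows "(c / 2)\<^sup>2 * real n ^ 3 - 2 * (real n)\<^sup>2 \<le> a_L2 \<Psi> n x"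
proof -
  let ?S = "\<lambda>j. \<Sum>k\<le>t_max x. (real (x k) - (real n - 1) * g_loo \<Psi> n x j k)\<^sup>2"
  have \<Psi>0: "0 \<le> \<Psi> (emp n x) k"
    by (rule prob_vectorsD(1)[OF map_emp_prob_vectors])
  then have "0 < emp n x k" using gap by linarith
  then have "0 < x k" by (auto simp: emp_def intro: Nat.gr0I)
  then have k: "k \<le> t_max x" by (rule freq_data_le_t_max[OF x])
  have S: "(real n * c / 2)\<^sup>2 \<le> ?S j" if "0 < x j" for j
  proof -
    have "(real n - 1) * (g_loo \<Psi> n x j k - \<Psi> (emp n x) k) \<le> 1"
      using g_loo_near_emp[OF that, of k] .
    moreover have "real n * c \<le> real (x k) - real n * \<Psi> (emp n x) k"
      using mult_left_mono[OF gap(2), of "real n"] n by (simp add: emp_def right_diff_distrib)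
    \<comment> \<open>Leaving one observation out costs 1, which \<open>2 \<le> real n * c\<close>
      bounds by half of nc.\<close>
    ultimately have "real n * c / 2 \<le> real (x k) - (real n - 1) * g_loo \<Psi> n x j k"
      using \<Psi>0 gap(3) by (simp add: algebra_simps)
    then have "(real n * c / 2)\<^sup>2 \<le> (real (x k) - (real n - 1) * g_loo \<Psi> n x j k)\<^sup>2"
      using gap(1) by (intro power_mono) auto
    also have "\<dots> \<le> ?S j"
      using k by (intro member_le_sum) auto
    finally show ?thesis .
  qed
  have "(\<Sum>j\<le>t_max x. real (x j) * (2 * (real (x j) - g_loo \<Psi> n x j j * (real n - 1)) - ?S j))
      \<le> (\<Sum>j\<le>t_max x. real (x j) * (2 * real n - (real n * c / 2)\<^sup>2))"
  proof (intro sum_mono)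
    fix j
    show "real (x j) * (2 * (real (x j) - g_loo \<Psi> n x j j * (real n - 1)) - ?S j)
        \<le> real (x j) * (2 * real n - (real n * c / 2)\<^sup>2)"
    proof (cases "x j = 0")
      case False
      have "0 \<le> g_loo \<Psi> n x j j * (real n - 1)" using g_loo_nonneg n by simp
      moreover have "real (x j) \<le> real n" using freq_data_le[OF x] by simp
      ultimately show ?thesis
        using S[of j] False by (intro mult_left_mono) auto
    qed simp
  qed
  also have "\<dots> = real n * (2 * real n - (real n * c / 2)\<^sup>2)"
    by (simp only: sum_distrib_right[symmetric] freq_data_sum_t_max[OF x])
  also have "\<dots> = 2 * (real n)\<^sup>2 - (c / 2)\<^sup>2 * real n ^ 3"
    by (simp add: power2_eq_square power3_eq_cube algebra_simps)
  finally show ?thesis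
    unfolding a_L2_def by simp
qed

lemma beta_L2_le:
  assumes gap: "0 < c" "c \<le> emp n x k - \<Psi> (emp n x) k" "32 \<le> real n * c\<^sup>2"
  shows "beta_L2 \<Psi> n x \<le> 16 / (c\<^sup>2 * real n)"
proof -
  have "c \<le> 1"
    using gap(2) prob_vectorsD(3)[OF emp_prob_vectors[OF x], of k]
      prob_vectorsD(1)[OF map_emp_prob_vectors, of k] n by simp
  then have "c\<^sup>2 \<le> c" using gap(1) by (simp add: power2_eq_square mult_left_le)
  then have nc: "2 \<le> real n * c"
    using gap(3) mult_left_mono[of "c\<^sup>2" c "real n"] by simp
  \<comment> \<open>The constant 32 makes c^2 n^3 / 4 at least 8n^2. After subtracting 2n^2 more
    than half of the cubic term is left, and the denominator exceeds the bound 2n^2 for the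
    numerator, so the ratio is the selected value.\<close>
  have "32 * (real n)\<^sup>2 \<le> c\<^sup>2 * real n ^ 3"
    using mult_left_mono[OF gap(3), of "(real n)\<^sup>2"] by (simp add: power2_eq_square power3_eq_cube ac_simps)
  moreover have "0 < (real n)\<^sup>2" using n by simp
  moreover have "c\<^sup>2 * real n ^ 3 / 4 - 2 * (real n)\<^sup>2 \<le> a_L2 \<Psi> n x"
    using a_L2_ge[OF gap(1,2) nc] by (simp add: power_divide)
  ultimately have a: "c\<^sup>2 * real n ^ 3 / 8 \<le> a_L2 \<Psi> n x" "2 * (real n)\<^sup>2 < a_L2 \<Psi> n x"
    by linarith+
  have apos: "0 < c\<^sup>2 * real n ^ 3 / 8" using gap(1) n by simp
  show ?thesis
  proof (cases "0 \<le> b_L2 \<Psi> n x")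
    case True
    have "b_L2 \<Psi> n x / a_L2 \<Psi> n x \<le> 2 * (real n)\<^sup>2 / (c\<^sup>2 * real n ^ 3 / 8)"
      using True b_L2_le a apos by (intro frac_le) auto
    also have "\<dots> = 16 / (c\<^sup>2 * real n)"
      using gap(1) n by (simp add: power2_eq_square power3_eq_cube)
    finally show ?thesis
      using True b_L2_le a apos by (simp add: beta_L2_def)
  next
    case False
    then show ?thesis using gap(1) by (simp add: beta_L2_def)
  qed
qed

end

text \<open>The difference of the two summands is (f - p)(f - \<Psi> f) + p((f - p) - (\<Psi> f -
  \<Psi> p)). Every sup-norm error is multiplied by entries of probability vectors, so the infinite
  sum stays bounded by a multiple of \<eta>.\<close>

lemma l2_inner_residual_perturb:
  assumes p: "p \<in> prob_vectors J" and f: "f \<in> prob_vectors J" and near: "\<And>j. \<bar>f j - p j\<bar> \<le> \<eta>"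
  shows "l2_inner p (\<lambda>j. p j - \<Psi> p j) - 4 * \<eta> \<le> l2_inner f (\<lambda>j. f j - \<Psi> f j)"
proof -
  have \<Psi>: "\<Psi> f \<in> prob_vectors J" "\<Psi> p \<in> prob_vectors J" using maps f p by auto
  have sm: "summable (\<lambda>j. h j * (h j - \<Psi> h j))" if "h \<in> prob_vectors J" for h
    using summable_diff[OF summable_prob_mult[OF that that] summable_prob_mult[OF that]] maps that
    by (simp add: right_diff_distrib)
  \<comment> \<open>The weights f, \<Psi> f and 2p have total masses 1, 1 and 2; this is the factor
    4.\<close>
  have "(\<lambda>j. p j * (p j - \<Psi> p j) - \<eta> * (f j + \<Psi> f j + 2 * p j))
      sums (l2_inner p (\<lambda>j. p j - \<Psi> p j) - \<eta> * (1 + 1 + 2 * 1))"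
    unfolding l2_inner_def
    by (intro sums_diff sums_add sums_mult summable_sums sm p prob_vectorsD(2)[OF f]
        prob_vectorsD(2)[OF p] prob_vectorsD(2)[OF \<Psi>(1)])
  moreover have "(\<lambda>j. f j * (f j - \<Psi> f j)) sums l2_inner f (\<lambda>j. f j - \<Psi> f j)"
    unfolding l2_inner_def by (intro summable_sums sm f)
  moreover have "p j * (p j - \<Psi> p j) - \<eta> * (f j + \<Psi> f j + 2 * p j) \<le> f j * (f j - \<Psi> f j)" for j
  proof -
    have c: "\<bar>\<Psi> f j - \<Psi> p j\<bar> \<le> \<eta>" by (rule linf_contractionD[OF contr maps f p near])
    have pos: "0 \<le> f j" "0 \<le> \<Psi> f j" "0 \<le> p j"
      using prob_vectorsD(1)[OF f] prob_vectorsD(1)[OF \<Psi>(1)] prob_vectorsD(1)[OF p] by blast+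
    have "- (\<eta> * (f j + \<Psi> f j)) \<le> (f j - p j) * (f j - \<Psi> f j)"
    proof -
      have "\<bar>(f j - p j) * (f j - \<Psi> f j)\<bar> \<le> \<eta> * (f j + \<Psi> f j)"
        unfolding abs_mult using near[of j] pos by (intro mult_mono) auto
      then show ?thesis by linarith
    qed
    moreover have "- (p j * (2 * \<eta>)) \<le> p j * ((f j - p j) - (\<Psi> f j - \<Psi> p j))"
      using c near[of j] pos(3) by (subst mult_minus_right[symmetric], intro mult_left_mono) auto
    ultimately show ?thesis by (simp add: algebra_simps)
  qed
  ultimately have "l2_inner p (\<lambda>j. p j - \<Psi> p j) - \<eta> * (1 + 1 + 2 * 1) \<le> l2_inner f (\<lambda>j. f j - \<Psi> f j)"
    by (rule sums_le[rotated])
  then show ?thesis by simp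
qed

text \<open>Subtracting the vanishing inner product of \<Psi> p with p - \<Psi> p turns the residual
  into a sum of squares, of which one term is kept.\<close>

lemma l2_inner_residual_ge_square:
  assumes proj: "projection_like J \<Psi>" and p: "p \<in> prob_vectors J"
  shows "(p k - \<Psi> p k)\<^sup>2 \<le> l2_inner p (\<lambda>j. p j - \<Psi> p j)"
proof -
  have \<Psi>: "\<Psi> p \<in> prob_vectors J" using maps p by auto
  have sm: "summable (\<lambda>j. p j * (p j - \<Psi> p j))" "summable (\<lambda>j. \<Psi> p j * (p j - \<Psi> p j))"
    unfolding right_diff_distrib
    by (intro summable_diff summable_prob_mult[OF p p] summable_prob_mult[OF p \<Psi>]
        summable_prob_mult[OF \<Psi> p] summable_prob_mult[OF \<Psi> \<Psi>])+
  have "(\<lambda>j. p j * (p j - \<Psi> p j) - \<Psi> p j * (p j - \<Psi> p j)) sums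
      (l2_inner p (\<lambda>j. p j - \<Psi> p j) - l2_inner (\<Psi> p) (\<lambda>j. p j - \<Psi> p j))"
    unfolding l2_inner_def by (intro sums_diff summable_sums sm)
  then have "(\<lambda>j. (p j - \<Psi> p j)\<^sup>2) sums l2_inner p (\<lambda>j. p j - \<Psi> p j)"
    using proj p by (simp add: projection_like_def power2_eq_square left_diff_distrib)
  then show ?thesis
    using sum_le_suminf[of "\<lambda>j. (p j - \<Psi> p j)\<^sup>2" "{k}"] by (auto simp: sums_iff)
qed

text \<open>A deterministic statement about all frequency data near p; chance enters later, only
  through the probability that the data are near p.\<close>

lemma mixture_beta_small:
  assumes proj: "projection_like J \<Psi>" and p: "p \<in> prob_vectors J" and ne: "\<Psi> p \<noteq> p"
  shows "\<exists>\<delta>>0. \<exists>C n0. \<forall>n\<ge>n0. \<forall>x. freq_data J n x \<longrightarrow> (\<forall>j. \<bar>emp n x j - p j\<bar> < \<delta>) \<longrightarrow>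
           mixture_beta d \<Psi> n x \<le> C / real n"
proof -
  obtain k where k: "\<Psi> p k < p k"
    using prob_vectors_exists_less[OF p _ ne] maps p by auto
  define c where "c = (p k - \<Psi> p k) / 2"
  have c: "0 < c" using k by (simp add: c_def)
  \<comment> \<open>The first bound keeps the gap at k, which is 2c for p, at least c for the
    empirical vector. The second keeps the empirical residual at least 4c^2 - 4\<delta> \<ge>
    2c^2.\<close>
  define \<delta> where "\<delta> = min (c / 2) (c\<^sup>2 / 2)"
  obtain n0 :: nat where n0: "32 / c\<^sup>2 < real n0" using reals_Archimedean2 by blast
  have "mixture_beta d \<Psi> n x \<le> (16 / c\<^sup>2) / real n"
    if n: "n \<ge> max n0 2" and x: "freq_data J n x" and near: "\<forall>j. \<bar>emp n x j - p j\<bar> < \<delta>" for n x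
  proof -
    have n2: "n \<ge> 2" "n \<ge> 1" using n by auto
    note e = emp_prob_vectors[OF x n2(2)]
    have nn: "32 \<le> real n * c\<^sup>2"
    proof -
      have "32 / c\<^sup>2 \<le> real n" using n n0 by (simp add: max_def split: if_splits)
      then show ?thesis using c by (simp add: field_simps)
    qed
    have near': "\<bar>emp n x j - p j\<bar> \<le> \<delta>" for j using near by (simp add: less_imp_le)
    have "\<bar>\<Psi> (emp n x) k - \<Psi> p k\<bar> \<le> \<delta>"
      by (rule linf_contractionD[OF contr maps e p near'])
    then have gap: "c \<le> emp n x k - \<Psi> (emp n x) k"
      using near'[of k] unfolding \<delta>_def c_def by (simp add: abs_le_iff min_def split: if_splits)
    show ?thesis
    proof (cases "d = 1")
      case True
      have "4 * c\<^sup>2 = (p k - \<Psi> p k)\<^sup>2" by (simp add: c_def power_divide)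
      also have "\<dots> \<le> l2_inner p (\<lambda>j. p j - \<Psi> p j)"
        by (rule l2_inner_residual_ge_square[OF proj p])
      also have "\<dots> \<le> l2_inner (emp n x) (\<lambda>j. emp n x j - \<Psi> (emp n x) j) + 4 * \<delta>"
        using l2_inner_residual_perturb[OF p e near'] by simp
      also have "4 * \<delta> \<le> 2 * c\<^sup>2" by (simp add: \<delta>_def)
      finally have "2 * c\<^sup>2 \<le> l2_inner (emp n x) (\<lambda>j. emp n x j - \<Psi> (emp n x) j)" by simp
      moreover have "2 / real n \<le> 2 * c\<^sup>2" using nn n2 by (simp add: field_simps)
      ultimately have "beta_L1 \<Psi> n x = 0"
        by (intro beta_L1_eq_0[OF x n2(1)]) simp
      then show ?thesis using True by (simp add: mixture_beta_def)
    next
      case False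
      then show ?thesis
        using beta_L2_le[OF x n2(1) c gap nn] by (simp add: mixture_beta_def)
    qed
  qed
  moreover have "0 < \<delta>" using c by (simp add: \<delta>_def)
  ultimately show ?thesis by blast
qed

end

subsection \<open>The empirical distribution\<close>

lemma (in prob_space) expectation_square_sum_indep:
  fixes V :: "nat \<Rightarrow> 'a \<Rightarrow> real"
  assumes indep: "indep_vars (\<lambda>_. borel) V UNIV"
    and sq: "\<And>i. integrable M (\<lambda>\<omega>. (V i \<omega>)\<^sup>2)" and mean: "\<And>i. expectation (V i) = 0"
  shows "integrable M (\<lambda>\<omega>. (\<Sum>i<n. V i \<omega>)\<^sup>2) \<and>
    expectation (\<lambda>\<omega>. (\<Sum>i<n. V i \<omega>)\<^sup>2) = (\<Sum>i<n. expectation (\<lambda>\<omega>. (V i \<omega>)\<^sup>2))"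
proof (induction n)
  case (Suc n)
  have [measurable]: "random_variable borel (V i)" for i
    using indep by (simp add: indep_vars_def2)
  let ?S = "\<lambda>\<omega>. \<Sum>i<n. V i \<omega>"
  have iV: "integrable M (V i)" for i
    by (rule square_integrable_imp_integrable[OF _ sq]) simp
  have iS: "integrable M ?S"
    using iV by simp
  have ind: "indep_var borel (V n) borel ?S"
    by (rule indep_vars_sum) (auto intro: indep_vars_subset[OF indep])
  note prod = indep_var_integrable[OF ind iV iS] indep_var_lebesgue_integral[OF ind iV iS]
  have eq: "(\<Sum>i<Suc n. V i \<omega>)\<^sup>2 = (?S \<omega>)\<^sup>2 + (2 * (V n \<omega> * ?S \<omega>) + (V n \<omega>)\<^sup>2)" for \<omega>
    by (simp add: power2_eq_square algebra_simps)
  show ?case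
    unfolding eq using Suc.IH prod sq mean[of n] by simp
qed (simp add: prob_space)

text \<open>The central limit theorem applies for positive variance; with variance 0 all summands
  vanish almost surely and both sides equal 1.\<close>

lemma (in prob_space) iid_cos_tendsto:
  fixes V :: "nat \<Rightarrow> 'a \<Rightarrow> real"
  assumes indep: "indep_vars (\<lambda>_. borel) V UNIV"
    and sq: "\<And>i. integrable M (\<lambda>\<omega>. (V i \<omega>)\<^sup>2)" and mean: "\<And>i. expectation (V i) = 0"
    and var: "\<And>i. expectation (\<lambda>\<omega>. (V i \<omega>)\<^sup>2) = v" and distr: "\<And>i. distr M borel (V i) = \<mu>"
  shows "(\<lambda>n. expectation (\<lambda>\<omega>. cos ((\<Sum>i<n. V i \<omega>) / sqrt (real n)))) \<longlonglongrightarrow> exp (- v / 2)"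
proof (cases "v = 0")
  case True
  have [measurable]: "random_variable borel (V i)" for i
    using indep by (simp add: indep_vars_def2)
  have "AE \<omega> in M. V i \<omega> = 0" for i
    using integral_nonneg_eq_0_iff_AE[OF sq[of i]] var[of i] True by simp
  then have ae: "AE \<omega> in M. \<forall>i. V i \<omega> = 0"
    by (simp add: AE_all_countable)
  have "expectation (\<lambda>\<omega>. cos ((\<Sum>i<n. V i \<omega>) / sqrt (real n))) = expectation (\<lambda>\<omega>. 1)" for n
    using ae by (intro integral_cong_AE) auto
  then show ?thesis using True by (simp add: prob_space)
next
  case False
  have [measurable]: "random_variable borel (V i)" for i
    using indep by (simp add: indep_vars_def2)
  have v: "0 < v"
    using var[of 0] integral_nonneg_AE[of "\<lambda>\<omega>. (V 0 \<omega>)\<^sup>2" M] False by auto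
  define \<sigma> where "\<sigma> = sqrt v"
  have \<sigma>: "0 < \<sigma>" "\<sigma>\<^sup>2 = v" using v by (auto simp: \<sigma>_def)
  let ?Z = "\<lambda>n \<omega>. (\<Sum>i<n. V i \<omega>) / sqrt (real n * \<sigma>\<^sup>2)"
  have "weak_conv_m (\<lambda>n. distr M borel (?Z n)) std_normal_distribution"
    by (rule central_limit_theorem_zero_mean[OF indep mean \<sigma>(1) sq _ distr]) (simp add: mean var \<sigma>(2))
  \<comment> \<open>Evaluating at \<sigma> undoes the division by \<sigma> in the standardized
    sum.\<close>
  then have "(\<lambda>n. char (distr M borel (?Z n)) \<sigma>) \<longlonglongrightarrow> char std_normal_distribution \<sigma>"
    by (intro levy_continuity1 real_dist_normal_dist real_distribution_distr) auto
  then have "(\<lambda>n. Re (char (distr M borel (?Z n)) \<sigma>)) \<longlonglongrightarrow> Re (char std_normal_distribution \<sigma>)"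
    by (rule tendsto_Re)
  moreover have "Re (char std_normal_distribution \<sigma>) = exp (- v / 2)"
    unfolding char_std_normal_distribution \<sigma>(2) by simp
  moreover have "Re (char (distr M borel (?Z n)) \<sigma>)
      = expectation (\<lambda>\<omega>. cos ((\<Sum>i<n. V i \<omega>) / sqrt (real n)))" for n
  proof -
    have "Re (char (distr M borel (?Z n)) \<sigma>) = expectation (\<lambda>\<omega>. Re (iexp (\<sigma> * ?Z n \<omega>)))"
      unfolding char_def
      by (subst integral_distr) (auto intro!: integral_Re[symmetric] integrable_const_bound[of _ 1])
    also have "\<dots> = expectation (\<lambda>\<omega>. cos ((\<Sum>i<n. V i \<omega>) / sqrt (real n)))"
      using \<sigma>(1) by (simp add: Re_exp real_sqrt_mult)
    finally show ?thesis .
  qed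
  ultimately show ?thesis by simp
qed

section \<open>Counts of an i.i.d. sequence of indices\<close>

locale iid_index = prob_space M for M :: "'a measure" +
  fixes J :: "nat set" and c :: "nat \<Rightarrow> 'a \<Rightarrow> nat" and p :: "nat \<Rightarrow> real"
  assumes indep: "indep_vars (\<lambda>_. count_space UNIV) c UNIV"
    and range: "\<omega> \<in> space M \<Longrightarrow> c i \<omega> \<in> J"
    and law: "prob {\<omega> \<in> space M. c i \<omega> = j} = p j"
    and p: "p \<in> prob_vectors J"
begin

definition cnt :: "nat \<Rightarrow> 'a \<Rightarrow> nat \<Rightarrow> nat" where
  "cnt n \<omega> j = card {i. i < n \<and> c i \<omega> = j}"

lemma c_measurable [measurable]: "c i \<in> measurable M (count_space UNIV)"
  using indep by (simp add: indep_vars_def2)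

lemma cnt_pos_iff: "0 < cnt n \<omega> j \<longleftrightarrow> j \<in> (\<lambda>i. c i \<omega>) ` {..<n}"
  by (auto simp: cnt_def card_gt_0_iff)

lemma freq_data_cnt:
  assumes "\<omega> \<in> space M"
  shows "freq_data J n (cnt n \<omega>)"
proof -
  have pos: "{j. 0 < cnt n \<omega> j} = (\<lambda>i. c i \<omega>) ` {..<n}"
    by (auto simp: cnt_pos_iff)
  have "(\<Sum>j\<in>(\<lambda>i. c i \<omega>) ` {..<n}. card {i \<in> {..<n}. c i \<omega> = j}) = n"
  proof -
    have "(\<Sum>i<n. 1) = (\<Sum>j\<in>(\<lambda>i. c i \<omega>) ` {..<n}. \<Sum>i | i \<in> {..<n} \<and> c i \<omega> = j. 1 :: nat)"
      by (rule sum.image_gen) simp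
    then show ?thesis by (simp only: card_eq_sum[symmetric] card_lessThan)
  qed
  then have "(\<Sum>j\<in>(\<lambda>i. c i \<omega>) ` {..<n}. cnt n \<omega> j) = n"
    by (simp only: cnt_def lessThan_iff)
  then show ?thesis
    unfolding freq_data_def pos using range[OF assms] by blast
qed

text \<open>The counts are a function of the list of the first n indices, and there are countably
  many lists. Hence the coverage event is measurable although it involves an arbitrary map and a
  quantile picked by choice.\<close>

lemma cnt_event: "{\<omega> \<in> space M. P (cnt n \<omega>)} \<in> events"
proof -
  define L where "L \<omega> = map (\<lambda>i. c i \<omega>) [0..<n]" for \<omega>
  have "L -` {l} \<inter> space M \<in> events" for l
  proof -
    have "L -` {l} \<inter> space M = {\<omega> \<in> space M. length l = n \<and> (\<forall>i\<in>{..<n}. c i \<omega> = l ! i)}"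
    proof -
      have "L \<omega> = l \<longleftrightarrow> length l = n \<and> (\<forall>i\<in>{..<n}. c i \<omega> = l ! i)" for \<omega>
        unfolding list_eq_iff_nth_eq[of "L \<omega>" l] by (auto simp: L_def)
      then show ?thesis by blast
    qed
    also have "\<dots> \<in> events" by measurable
    finally show ?thesis .
  qed
  then have L: "L \<in> measurable M (count_space UNIV)"
    by (simp add: measurable_count_space_eq_countable)
  define C where "C l j = card {i. i < n \<and> l ! i = j}" for l :: "nat list" and j
  have cnt: "cnt n \<omega> = C (L \<omega>)" for \<omega>
  proof
    fix j
    have "{i. i < n \<and> c i \<omega> = j} = {i. i < n \<and> L \<omega> ! i = j}"
      by (auto simp: L_def)
    then show "cnt n \<omega> j = C (L \<omega>) j"
      by (simp add: cnt_def C_def)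
  qed
  have "{\<omega> \<in> space M. P (cnt n \<omega>)} = L -` {l. P (C l)} \<inter> space M"
    unfolding cnt by blast
  also have "\<dots> \<in> events" using L by (rule measurable_sets) simp
  finally show ?thesis .
qed

definition point :: "nat \<Rightarrow> nat \<Rightarrow> real" where
  "point j k = (if k = j then 1 else 0)"

lemma expectation_point: "expectation (\<lambda>\<omega>. point j (c i \<omega>)) = p j"
proof -
  have "expectation (\<lambda>\<omega>. point j (c i \<omega>)) = expectation (indicator {\<omega> \<in> space M. c i \<omega> = j})"
    by (intro Bochner_Integration.integral_cong) (auto simp: indicator_def point_def)
  also have "\<dots> = prob {\<omega> \<in> space M. c i \<omega> = j}"
    by simp
  finally show ?thesis by (simp only: law)
qed

lemma integrable_of_c: "finite A \<Longrightarrow> (\<And>k. k \<notin> A \<Longrightarrow> f k = (a::real)) \<Longrightarrow> integrable M (\<lambda>\<omega>. f (c i \<omega>))"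
proof (rule integrable_const_bound)
  assume f: "finite A" "\<And>k. k \<notin> A \<Longrightarrow> f k = a"
  have "\<bar>f k\<bar> \<le> \<bar>a\<bar> + (\<Sum>k\<in>A. \<bar>f k\<bar>)" for k
    using f member_le_sum[of k A "\<lambda>k. \<bar>f k\<bar>"] by (cases "k \<in> A") (auto simp: sum_nonneg)
  then show "AE \<omega> in M. norm (f (c i \<omega>)) \<le> \<bar>a\<bar> + (\<Sum>k\<in>A. \<bar>f k\<bar>)"
    by simp
qed measurable

definition dev :: "nat \<Rightarrow> nat \<Rightarrow> 'a \<Rightarrow> real" where
  "dev n j \<omega> = sqrt (real n) * (emp n (cnt n \<omega>) j - p j)"

definition centered :: "(nat \<Rightarrow> real) \<Rightarrow> nat \<Rightarrow> nat \<Rightarrow> real" where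
  "centered u m k = (\<Sum>j<m. u j * (point j k - p j))"

text \<open>The Cramer-Wold reduction: a linear form of the rescaled empirical process is a
  normalized sum of i.i.d. real variables.\<close>

lemma sum_dev_eq_centered: "(\<Sum>j<m. u j * dev n j \<omega>) = (\<Sum>i<n. centered u m (c i \<omega>)) / sqrt (real n)"
proof -
  have dev: "dev n j \<omega> = (\<Sum>i<n. point j (c i \<omega>) - p j) / sqrt (real n)" for j
  proof (cases "n = 0")
    case False
    have "real (cnt n \<omega> j) = (\<Sum>i<n. point j (c i \<omega>))"
      by (simp add: cnt_def point_def Int_def flip: sum.inter_filter)
    moreover have "sqrt (real n) * a / real n = a / sqrt (real n)" for a
      using False by (simp add: field_simps)
    ultimately show ?thesis
      using False unfolding dev_def emp_def by (simp add: sum_subtractf field_simps)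
  qed (simp add: dev_def)
  have "(\<Sum>j<m. u j * dev n j \<omega>) = (\<Sum>j<m. \<Sum>i<n. u j * (point j (c i \<omega>) - p j)) / sqrt (real n)"
    unfolding dev by (simp add: sum_divide_distrib sum_distrib_left)
  also have "(\<Sum>j<m. \<Sum>i<n. u j * (point j (c i \<omega>) - p j)) = (\<Sum>i<n. centered u m (c i \<omega>))"
    unfolding centered_def by (rule sum.swap)
  finally show ?thesis .
qed

lemma centered_alt: "centered u m k = (\<Sum>j<m. u j * point j k) - (\<Sum>j<m. u j * p j)"
  by (simp add: centered_def right_diff_distrib sum_subtractf)

lemma centered_moments:
  "integrable M (\<lambda>\<omega>. centered u m (c i \<omega>))" "expectation (\<lambda>\<omega>. centered u m (c i \<omega>)) = 0"
  "integrable M (\<lambda>\<omega>. (centered u m (c i \<omega>))\<^sup>2)"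
  "expectation (\<lambda>\<omega>. (centered u m (c i \<omega>))\<^sup>2) = (\<Sum>j<m. (u j)\<^sup>2 * p j) - (\<Sum>j<m. u j * p j)\<^sup>2"
proof -
  let ?\<mu> = "\<Sum>j<m. u j * p j"
  have int: "integrable M (\<lambda>\<omega>. point j (c i \<omega>))" for j
    by (rule integrable_of_c[of "{j}" _ 0]) (auto simp: point_def)
  show "integrable M (\<lambda>\<omega>. centered u m (c i \<omega>))"
    unfolding centered_def using int by simp
  show mean: "expectation (\<lambda>\<omega>. centered u m (c i \<omega>)) = 0"
    unfolding centered_def using int by (simp add: expectation_point prob_space)
  have sq: "(centered u m k)\<^sup>2 = (\<Sum>j<m. (u j)\<^sup>2 * point j k) - 2 * ?\<mu> * centered u m k - ?\<mu>\<^sup>2" for k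
  proof -
    \<comment> \<open>At most one indicator is nonzero, so squaring acts on the coefficients
      only.\<close>
    have "(\<Sum>j<m. u j * point j k)\<^sup>2 = (\<Sum>j<m. (u j)\<^sup>2 * point j k)"
      by (cases "k < m") (auto simp: point_def if_distrib cong: if_cong)
    then show ?thesis
      unfolding centered_alt by (simp add: power2_eq_square algebra_simps)
  qed
  show "integrable M (\<lambda>\<omega>. (centered u m (c i \<omega>))\<^sup>2)"
    unfolding sq using int \<open>integrable M (\<lambda>\<omega>. centered u m (c i \<omega>))\<close> by simp
  show "expectation (\<lambda>\<omega>. (centered u m (c i \<omega>))\<^sup>2) = (\<Sum>j<m. (u j)\<^sup>2 * p j) - ?\<mu>\<^sup>2"
    unfolding sq using int \<open>integrable M (\<lambda>\<omega>. centered u m (c i \<omega>))\<close> mean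
    by (simp add: expectation_point prob_space)
qed

lemma indep_centered: "indep_vars (\<lambda>_. borel) (\<lambda>i \<omega>. centered u m (c i \<omega>)) UNIV"
  by (rule indep_vars_compose2[OF indep]) simp

lemma distr_centered: "distr M borel (\<lambda>\<omega>. centered u m (c i \<omega>)) = distr M borel (\<lambda>\<omega>. centered u m (c 0 \<omega>))"
proof -
  have "distr M (count_space UNIV) (c i) = distr M (count_space UNIV) (c 0)"
  proof (rule measure_eqI_countable[of _ UNIV])
    fix j
    show "emeasure (distr M (count_space UNIV) (c i)) {j} = emeasure (distr M (count_space UNIV) (c 0)) {j}"
      using law[of i j] law[of 0 j]
      by (simp add: emeasure_distr emeasure_eq_measure vimage_def Int_def conj_commute)
  qed auto
  then have "distr (distr M (count_space UNIV) (c i)) borel (centered u m) = distr (distr M (count_space UNIV) (c 0)) borel (centered u m)"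
    by simp
  then show ?thesis
    by (simp add: distr_distr comp_def)
qed

lemma dev_measurable [measurable]: "random_variable borel (dev n j)"
proof -
  have "(\<lambda>\<omega>. cnt n \<omega> j) -` {k} \<inter> space M = {\<omega> \<in> space M. cnt n \<omega> j = k}" for k
    by blast
  then have "(\<lambda>\<omega>. cnt n \<omega> j) -` {k} \<inter> space M \<in> events" for k
    using cnt_event[of "\<lambda>x. x j = k"] by simp
  then have [measurable]: "(\<lambda>\<omega>. cnt n \<omega> j) \<in> measurable M (count_space UNIV)"
    by (simp add: measurable_count_space_eq_countable)
  show ?thesis
    unfolding dev_def emp_def by measurable
qed

lemma dev_cos_tendsto:
  "(\<lambda>n. expectation (\<lambda>\<omega>. cos (\<Sum>j<m. u j * dev n j \<omega>))) \<longlonglongrightarrow>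
     exp (- ((\<Sum>j<m. (u j)\<^sup>2 * p j) - (\<Sum>j<m. u j * p j)\<^sup>2) / 2)"
  unfolding sum_dev_eq_centered
  by (rule iid_cos_tendsto[where V = "\<lambda>i \<omega>. centered u m (c i \<omega>)",
        OF indep_centered centered_moments(3,2,4) distr_centered])

text \<open>The point of the bound is that it does not depend on n and sums to 1 over j.\<close>

lemma dev_square: "integrable M (\<lambda>\<omega>. (dev n j \<omega>)\<^sup>2)" "expectation (\<lambda>\<omega>. (dev n j \<omega>)\<^sup>2) \<le> p j"
proof -
  let ?u = "point j"
  let ?S = "\<lambda>\<omega>. \<Sum>i<n. centered ?u (Suc j) (c i \<omega>)"
  have eq: "(dev n j \<omega>)\<^sup>2 = (?S \<omega>)\<^sup>2 / real n" for \<omega>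
  proof -
    have "(\<Sum>k<Suc j. ?u k * dev n k \<omega>) = dev n j \<omega>"
      by (simp add: point_def)
    then show ?thesis
      using sum_dev_eq_centered[of ?u n \<omega> "Suc j"] by (simp add: power_divide)
  qed
  note s = expectation_square_sum_indep[OF indep_centered centered_moments(3,2), of ?u "Suc j" n]
  show "integrable M (\<lambda>\<omega>. (dev n j \<omega>)\<^sup>2)"
    unfolding eq using conjunct1[OF s] by (rule Bochner_Integration.integrable_divide)
  have "(\<Sum>k<Suc j. (?u k)\<^sup>2 * p k) = p j" "(\<Sum>k<Suc j. ?u k * p k) = p j"
    by (simp_all add: point_def)
  then have var: "expectation (\<lambda>\<omega>. (centered ?u (Suc j) (c i \<omega>))\<^sup>2) = p j - (p j)\<^sup>2" for i
    by (simp only: centered_moments(4))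
  have "expectation (\<lambda>\<omega>. (dev n j \<omega>)\<^sup>2) = (\<Sum>i<n. p j - (p j)\<^sup>2) / real n"
    unfolding eq Bochner_Integration.integral_divide_zero conjunct2[OF s] var ..
  also have "\<dots> \<le> p j"
    using prob_vectorsD(1)[OF p, of j] by (cases "n = 0") simp_all
  finally show "expectation (\<lambda>\<omega>. (dev n j \<omega>)\<^sup>2) \<le> p j" .
qed

text \<open>All coordinates are handled at once, since the Chebyshev bounds p_j / (\<delta>^2 n) sum
  to 1 / (\<delta>^2 n).\<close>

lemma emp_consistent:
  assumes "0 < \<delta>"
  shows "(\<lambda>n. prob {\<omega> \<in> space M. \<exists>j. \<delta> \<le> \<bar>emp n (cnt n \<omega>) j - p j\<bar>}) \<longlonglongrightarrow> 0"
proof (rule tendsto_sandwich[of "\<lambda>_. 0" _ _ "\<lambda>n. (1 / \<delta>\<^sup>2) * (1 / real n)"])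
  show "\<forall>\<^sub>F n in sequentially. prob {\<omega> \<in> space M. \<exists>j. \<delta> \<le> \<bar>emp n (cnt n \<omega>) j - p j\<bar>} \<le> (1 / \<delta>\<^sup>2) * (1 / real n)"
    using eventually_gt_at_top[of 0]
  proof eventually_elim
    case (elim n)
    let ?a = "\<delta> * sqrt (real n)"
    have s: "(\<lambda>j. p j / ?a\<^sup>2) sums (1 / ?a\<^sup>2)"
      using prob_vectorsD(2)[OF p] by (rule sums_divide)
    have "{\<omega> \<in> space M. \<exists>j. \<delta> \<le> \<bar>emp n (cnt n \<omega>) j - p j\<bar>} = {\<omega> \<in> space M. \<exists>j. ?a \<le> \<bar>dev n j \<omega>\<bar>}"
      using elim by (simp add: dev_def abs_mult mult.commute)
    also have "prob \<dots> \<le> (\<Sum>j. p j / ?a\<^sup>2)"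
      using elim assms
      by (intro prob_exists_ge_le[where X = "dev n" and v = p, OF dev_measurable dev_square _ sums_summable[OF s]]) simp
    also have "\<dots> = (1 / \<delta>\<^sup>2) * (1 / real n)"
      using sums_unique[OF s] by (simp add: power_mult_distrib)
    finally show ?case .
  qed
  show "(\<lambda>n. (1 / \<delta>\<^sup>2) * (1 / real n)) \<longlonglongrightarrow> 0"
    by (intro tendsto_mult_right_zero lim_1_over_n)
qed auto

end

subsection \<open>Coverage\<close>

text \<open>Raising the lower end of the band to 0 cannot exclude a nonnegative value.\<close>

lemma mem_band_iff:
  assumes "0 \<le> a" "0 < n"
  shows "a \<in> band \<phi> q n j \<longleftrightarrow> sqrt (real n) * \<bar>\<phi> j - a\<bar> \<le> q"
proof -
  have "a \<in> band \<phi> q n j \<longleftrightarrow> \<bar>\<phi> j - a\<bar> \<le> q / sqrt (real n)"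
    using assms(1) by (auto simp: band_def abs_le_iff)
  then show ?thesis
    using assms(2) by (simp add: pos_le_divide_eq mult.commute)
qed

lemma divide_sqrt_tendsto_0: "(\<lambda>n. a / sqrt (real n)) \<longlonglongrightarrow> 0"
  by (intro tendsto_divide_0[OF tendsto_const] filterlim_at_top_imp_at_infinity
      filterlim_compose[OF sqrt_at_top filterlim_real_sequentially])

text \<open>The Gaussian processes live on a space N of their own, so the quantile is a
  deterministic function of the data; this expresses that the data are held fixed.\<close>

locale band_setup = iid_index M J c p + N: prob_space N
  for M :: "'a measure" and J c p and N :: "'b measure" +
  fixes Y :: "(nat \<Rightarrow> real) \<Rightarrow> nat \<Rightarrow> 'b \<Rightarrow> real" and \<alpha> :: real
  assumes gauss: "f \<in> prob_vectors J \<Longrightarrow> gaussian_process N f (Y f)"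
    and \<alpha>: "0 < \<alpha>" "\<alpha> < 1"
begin

definition coverage :: "(nat \<Rightarrow> (nat \<Rightarrow> nat) \<Rightarrow> nat \<Rightarrow> real) \<Rightarrow> nat \<Rightarrow> real" where
  "coverage \<phi> n = prob {\<omega> \<in> space M. \<forall>j. p j \<in> band (\<phi> n (cnt n \<omega>)) (sup_quantile N (Y (\<phi> n (cnt n \<omega>))) \<alpha>) n j}"

definition limit_cdf :: "real \<Rightarrow> real" where
  "limit_cdf t = N.prob {\<omega> \<in> space N. \<forall>j. \<bar>Y p j \<omega>\<bar> \<le> t}"

lemma limit_cdf_mono: "t \<le> t' \<Longrightarrow> limit_cdf t \<le> limit_cdf t'"
proof -
  note [measurable] = N.gaussian_process_measurable[OF gauss[OF p]]
  show "t \<le> t' \<Longrightarrow> limit_cdf t \<le> limit_cdf t'"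
    unfolding limit_cdf_def by (intro N.finite_measure_mono) (auto intro: order_trans)
qed

lemma limit_cdf_less: "limit_cdf t < limit_cdf t' \<Longrightarrow> t < t'"
  using limit_cdf_mono[of t' t] by linarith

context
  fixes j0
  assumes j0: "0 < p j0" "p j0 < 1"
begin

lemma limit_cdf_level:
  assumes "0 < l" "l < 1"
  obtains t where "limit_cdf t = l"
proof
  show "limit_cdf (sup_quantile N (Y p) (1 - l)) = l"
    unfolding limit_cdf_def using N.gaussian_sup_quantile[OF gauss[OF p] j0, of "1 - l"] assms by simp
qed

lemma dev_cdf_tendsto:
  "(\<lambda>n. prob {\<omega> \<in> space M. \<forall>j. \<bar>dev n j \<omega>\<bar> \<le> t}) \<longlonglongrightarrow> limit_cdf t"
  unfolding limit_cdf_def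
proof (rule sup_norm_cdf_tendsto[where v = "\<lambda>_. p" and w = p])
  note gp = gauss[OF p]
  show "(\<lambda>n. expectation (\<lambda>\<omega>. cos (\<Sum>j<m. u j * dev n j \<omega>)))
      \<longlonglongrightarrow> N.expectation (\<lambda>\<omega>. cos (\<Sum>j<m. u j * Y p j \<omega>))" for m u
    unfolding N.gaussian_process_cos[OF gp] by (rule dev_cos_tendsto)
  show "isCont (\<lambda>t. N.prob {\<omega> \<in> space N. \<forall>j. \<bar>Y p j \<omega>\<bar> \<le> t}) t"
    by (rule N.gaussian_sup_cdf_continuous[OF gp j0])
  show "N.expectation (\<lambda>\<omega>. (Y p j \<omega>)\<^sup>2) \<le> p j" for j
    using N.gaussian_process_coordinate(3)[OF gp, of j] by simp
  show "integrable N (\<lambda>\<omega>. (Y p j \<omega>)\<^sup>2)" "Y p j \<in> borel_measurable N" for j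
    by (rule N.gaussian_process_square_integrable[OF gp] N.gaussian_process_measurable[OF gp])+
  show "0 \<le> p j" "p sums 1" for j
    by (rule prob_vectorsD[OF p])+
  show "0 \<le> p j" "p sums 1" for j
    by (rule prob_vectorsD[OF p])+
  show "prob_space M" "prob_space N" by unfold_locales
qed (auto simp: dev_square)

lemma coverage_lower:
  assumes \<phi>: "\<And>n x. freq_data J n x \<Longrightarrow> 0 < n \<Longrightarrow> \<phi> n x \<in> prob_vectors J"
    and close: "0 < \<delta>0" "0 \<le> C" "\<And>n x b j. n \<ge> n0 \<Longrightarrow> freq_data J n x \<Longrightarrow> \<forall>j. \<bar>emp n x j - p j\<bar> < \<delta>0 \<Longrightarrow>
      \<forall>j. \<bar>emp n x j - p j\<bar> \<le> b \<Longrightarrow> \<bar>\<phi> n x j - p j\<bar> \<le> b + C / real n"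
    and e: "0 < e"
  shows "\<forall>\<^sub>F n in sequentially. 1 - \<alpha> - e \<le> coverage \<phi> n"
proof -
  \<comment> \<open>With level 1 - \<alpha> - 2h for \<open>a2\<close>, an error h for the limit of
    the distribution function and h for data far from p, the total loss is 4h.\<close>
  define h where "h = min (e / 4) ((1 - \<alpha>) / 4)"
  have h: "0 < h" "4 * h \<le> e" "4 * h \<le> 1 - \<alpha>" using e \<alpha> by (auto simp: h_def min_def)
  obtain a1 where a1: "limit_cdf a1 = 1 - \<alpha> - h" using limit_cdf_level[of "1 - \<alpha> - h"] h \<alpha> by auto
  obtain a2 where a2: "limit_cdf a2 = 1 - \<alpha> - 2 * h" using limit_cdf_level[of "1 - \<alpha> - 2 * h"] h \<alpha> by auto
  obtain b where b: "limit_cdf b = 1 - \<alpha> / 2" using limit_cdf_level[of "1 - \<alpha> / 2"] \<alpha> by auto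
  have a21: "a2 < a1" using limit_cdf_less[of a2 a1] a1 a2 h by simp
  have "limit_cdf a1 < 1 - \<alpha>" "1 - \<alpha> < limit_cdf b" using a1 b h \<alpha> by auto
  from N.gaussian_sup_quantile_stable[OF gauss p j0 \<alpha> this[unfolded limit_cdf_def]]
  obtain \<delta>1 where \<delta>1: "0 < \<delta>1" "\<And>f. f \<in> prob_vectors J \<Longrightarrow> \<forall>j. \<bar>f j - p j\<bar> < \<delta>1 \<Longrightarrow>
      a1 < sup_quantile N (Y f) \<alpha>"
    by blast
  \<comment> \<open>Half of \<delta>1 is reserved for the term C / n.\<close>
  define \<delta> where "\<delta> = min \<delta>0 (\<delta>1 / 2)"
  have \<delta>: "0 < \<delta>" using close(1) \<delta>1(1) by (simp add: \<delta>_def)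
  have ev1: "\<forall>\<^sub>F n in sequentially. prob {\<omega> \<in> space M. \<exists>j. \<delta> \<le> \<bar>emp n (cnt n \<omega>) j - p j\<bar>} < h"
    using emp_consistent[OF \<delta>] h(1) by (rule order_tendstoD(2))
  have ev2: "\<forall>\<^sub>F n in sequentially. limit_cdf a2 - h < prob {\<omega> \<in> space M. \<forall>j. \<bar>dev n j \<omega>\<bar> \<le> a2}"
    using dev_cdf_tendsto[of a2] by (rule order_tendstoD(1)) (use h in simp)
  have ev3: "\<forall>\<^sub>F n in sequentially. C / sqrt (real n) < min (\<delta>1 / 2) (a1 - a2)"
    using divide_sqrt_tendsto_0[of C] by (rule order_tendstoD(2)) (use \<delta>1 a21 in simp)
  show ?thesis
    using ev1 ev2 ev3 eventually_ge_at_top[of n0] eventually_gt_at_top[of 0]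
  proof eventually_elim
    case (elim n)
    let ?good = "{\<omega> \<in> space M. \<forall>j. \<bar>dev n j \<omega>\<bar> \<le> a2}"
    let ?bad = "{\<omega> \<in> space M. \<exists>j. \<delta> \<le> \<bar>emp n (cnt n \<omega>) j - p j\<bar>}"
    let ?cov = "{\<omega> \<in> space M. \<forall>j. p j \<in> band (\<phi> n (cnt n \<omega>)) (sup_quantile N (Y (\<phi> n (cnt n \<omega>))) \<alpha>) n j}"
    have ev: "?bad \<in> events" "?cov \<in> events"
      by (rule cnt_event)+
    have sq: "sqrt (real n) * sqrt (real n) = real n" "0 < sqrt (real n)"
      using elim(5) by auto
    have sC: "sqrt (real n) * (C / real n) = C / sqrt (real n)"
      using sqrt_divide_self_eq[of "real n"] by (simp add: divide_inverse mult.left_commute)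
    have "1 \<le> sqrt (real n)" using elim(5) by simp
    from mult_left_mono[OF this, of "sqrt (real n)"] have "sqrt (real n) \<le> real n"
      using sq by simp
    from divide_left_mono[OF this close(2)] have Cn: "C / real n \<le> C / sqrt (real n)"
      using elim(5) sq(2) by simp
    have "\<omega> \<in> ?cov" if \<omega>: "\<omega> \<in> space M" and g: "\<forall>j. \<bar>dev n j \<omega>\<bar> \<le> a2"
      and near: "\<forall>j. \<bar>emp n (cnt n \<omega>) j - p j\<bar> < \<delta>" for \<omega>
    proof -
      let ?x = "cnt n \<omega>"
      note x = freq_data_cnt[OF \<omega>, of n]
      have near0: "\<forall>j. \<bar>emp n ?x j - p j\<bar> < \<delta>0" using near by (auto simp: \<delta>_def)
      have "\<bar>\<phi> n ?x j - p j\<bar> \<le> \<delta> + C / real n" for j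
        using near by (intro close(3) elim x near0) (simp add: less_imp_le)
      moreover have "\<delta> + C / real n < \<delta>1"
      proof -
        have "C / sqrt (real n) < \<delta>1 / 2" "\<delta> \<le> \<delta>1 / 2"
          using elim(3) by (simp_all only: min_less_iff_conj \<delta>_def min.cobounded2)
        then show ?thesis using Cn by linarith
      qed
      ultimately have "\<forall>j. \<bar>\<phi> n ?x j - p j\<bar> < \<delta>1" by (meson le_less_trans)
      then have q: "a1 < sup_quantile N (Y (\<phi> n ?x)) \<alpha>"
        by (intro \<delta>1(2) \<phi> x elim(5))
      have "\<bar>emp n ?x j - p j\<bar> \<le> a2 / sqrt (real n)" for j
        using g[rule_format, of j] sq(2) by (simp add: dev_def abs_mult pos_le_divide_eq mult.commute)
      then have "\<bar>\<phi> n ?x j - p j\<bar> \<le> a2 / sqrt (real n) + C / real n" for j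
        by (intro close(3) elim x near0) simp
      from mult_left_mono[OF this, of "sqrt (real n)"]
      have "sqrt (real n) * \<bar>\<phi> n ?x j - p j\<bar> \<le> sqrt (real n) * (a2 / sqrt (real n) + C / real n)" for j
        by simp
      also have "sqrt (real n) * (a2 / sqrt (real n) + C / real n) = a2 + C / sqrt (real n)"
        unfolding distrib_left sC using elim(5) by simp
      also have "a2 + C / sqrt (real n) \<le> a1" using elim(3) by simp
      finally have "sqrt (real n) * \<bar>\<phi> n ?x j - p j\<bar> \<le> sup_quantile N (Y (\<phi> n ?x)) \<alpha>" for j
        using q by (meson less_imp_le order_trans)
      then show ?thesis
        using \<omega> mem_band_iff[OF prob_vectorsD(1)[OF p] elim(5)] by simp
    qed
    then have "?good \<subseteq> ?cov \<union> ?bad"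
      by (auto simp: not_le[symmetric])
    then have "prob ?good \<le> prob (?cov \<union> ?bad)"
      using ev by (intro finite_measure_mono) auto
    also have "\<dots> \<le> prob ?cov + prob ?bad"
      using ev by (intro measure_Un_le) auto
    finally show ?case
      unfolding coverage_def using elim(1,2) a2 h by linarith
  qed
qed

text \<open>The inclusion of events is reversed: a covered p forces the empirical deviations below
  \<open>b2\<close>. For this the estimator has to be close to the empirical vector itself, which is
  available when \<Psi> p differs from p.\<close>

lemma coverage_upper:
  assumes \<phi>: "\<And>n x. freq_data J n x \<Longrightarrow> 0 < n \<Longrightarrow> \<phi> n x \<in> prob_vectors J"
    and close: "0 < \<delta>0" "0 \<le> C" "\<And>n x j. n \<ge> n0 \<Longrightarrow> freq_data J n x \<Longrightarrow> \<forall>j. \<bar>emp n x j - p j\<bar> < \<delta>0 \<Longrightarrow>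
      \<bar>\<phi> n x j - emp n x j\<bar> \<le> C / real n"
    and e: "0 < e"
  shows "\<forall>\<^sub>F n in sequentially. coverage \<phi> n \<le> 1 - \<alpha> + e"
proof -
  define h where "h = min (e / 4) (\<alpha> / 4)"
  have h: "0 < h" "4 * h \<le> e" "4 * h \<le> \<alpha>" using e \<alpha> by (auto simp: h_def min_def)
  obtain b1 where b1: "limit_cdf b1 = 1 - \<alpha> + h" using limit_cdf_level[of "1 - \<alpha> + h"] h \<alpha> by auto
  obtain b2 where b2: "limit_cdf b2 = 1 - \<alpha> + 2 * h" using limit_cdf_level[of "1 - \<alpha> + 2 * h"] h \<alpha> by auto
  obtain a where a: "limit_cdf a = (1 - \<alpha>) / 2" using limit_cdf_level[of "(1 - \<alpha>) / 2"] \<alpha> by auto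
  have b12: "b1 < b2" using limit_cdf_less[of b1 b2] b1 b2 h by simp
  have "limit_cdf a < 1 - \<alpha>" "1 - \<alpha> < limit_cdf b1" using b1 a h \<alpha> by auto
  from N.gaussian_sup_quantile_stable[OF gauss p j0 \<alpha> this[unfolded limit_cdf_def]]
  obtain \<delta>1 where \<delta>1: "0 < \<delta>1" "\<And>f. f \<in> prob_vectors J \<Longrightarrow> \<forall>j. \<bar>f j - p j\<bar> < \<delta>1 \<Longrightarrow>
      sup_quantile N (Y f) \<alpha> < b1"
    by blast
  define \<delta> where "\<delta> = min \<delta>0 (\<delta>1 / 2)"
  have \<delta>: "0 < \<delta>" using close(1) \<delta>1(1) by (simp add: \<delta>_def)
  have ev1: "\<forall>\<^sub>F n in sequentially. prob {\<omega> \<in> space M. \<exists>j. \<delta> \<le> \<bar>emp n (cnt n \<omega>) j - p j\<bar>} < h"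
    using emp_consistent[OF \<delta>] h(1) by (rule order_tendstoD(2))
  have ev2: "\<forall>\<^sub>F n in sequentially. prob {\<omega> \<in> space M. \<forall>j. \<bar>dev n j \<omega>\<bar> \<le> b2} < limit_cdf b2 + h"
    using dev_cdf_tendsto[of b2] by (rule order_tendstoD(2)) (use h in simp)
  have ev3: "\<forall>\<^sub>F n in sequentially. C / sqrt (real n) < min (\<delta>1 / 2) (b2 - b1)"
    using divide_sqrt_tendsto_0[of C] by (rule order_tendstoD(2)) (use \<delta>1 b12 in simp)
  show ?thesis
    using ev1 ev2 ev3 eventually_ge_at_top[of n0] eventually_gt_at_top[of 0]
  proof eventually_elim
    case (elim n)
    let ?good = "{\<omega> \<in> space M. \<forall>j. \<bar>dev n j \<omega>\<bar> \<le> b2}"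
    let ?bad = "{\<omega> \<in> space M. \<exists>j. \<delta> \<le> \<bar>emp n (cnt n \<omega>) j - p j\<bar>}"
    let ?cov = "{\<omega> \<in> space M. \<forall>j. p j \<in> band (\<phi> n (cnt n \<omega>)) (sup_quantile N (Y (\<phi> n (cnt n \<omega>))) \<alpha>) n j}"
    have ev: "?bad \<in> events" "?good \<in> events"
      by (rule cnt_event) measurable
    have sq: "sqrt (real n) * sqrt (real n) = real n" "0 < sqrt (real n)"
      using elim(5) by auto
    have sC: "sqrt (real n) * (C / real n) = C / sqrt (real n)"
      using sqrt_divide_self_eq[of "real n"] by (simp add: divide_inverse mult.left_commute)
    have "1 \<le> sqrt (real n)" using elim(5) by simp
    from mult_left_mono[OF this, of "sqrt (real n)"] have "sqrt (real n) \<le> real n"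
      using sq by simp
    from divide_left_mono[OF this close(2)] have Cn: "C / real n \<le> C / sqrt (real n)"
      using elim(5) sq(2) by simp
    have "\<omega> \<in> ?good" if \<omega>: "\<omega> \<in> space M" and cov: "\<omega> \<in> ?cov"
      and near: "\<forall>j. \<bar>emp n (cnt n \<omega>) j - p j\<bar> < \<delta>" for \<omega>
    proof -
      let ?x = "cnt n \<omega>"
      note x = freq_data_cnt[OF \<omega>, of n]
      have near0: "\<forall>j. \<bar>emp n ?x j - p j\<bar> < \<delta>0" using near by (auto simp: \<delta>_def)
      have \<phi>e: "\<bar>\<phi> n ?x j - emp n ?x j\<bar> \<le> C / real n" for j
        by (intro close(3) elim x near0)
      have "\<bar>\<phi> n ?x j - p j\<bar> < \<delta>1" for j
      proof -
        have "\<bar>emp n ?x j - p j\<bar> < \<delta>1 / 2" "C / sqrt (real n) < \<delta>1 / 2"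
          using near elim(3) by (simp_all only: min_less_iff_conj \<delta>_def)
        then show ?thesis using Cn \<phi>e[of j] by linarith
      qed
      then have q: "sup_quantile N (Y (\<phi> n ?x)) \<alpha> < b1"
        by (intro \<delta>1(2) \<phi> x elim(5)) simp
      have "\<bar>dev n j \<omega>\<bar> \<le> b2" for j
      proof -
        have "\<bar>emp n ?x j - p j\<bar> \<le> \<bar>\<phi> n ?x j - p j\<bar> + C / real n"
          using \<phi>e[of j] by linarith
        \<comment> \<open>The shift C / sqrt n fits into the gap between \<open>b1\<close>, which
          bounds the quantile, and \<open>b2\<close>.\<close>
        from mult_left_mono[OF this, of "sqrt (real n)"]
        have "\<bar>dev n j \<omega>\<bar> \<le> sqrt (real n) * \<bar>\<phi> n ?x j - p j\<bar> + C / sqrt (real n)"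
          unfolding distrib_left sC by (simp add: dev_def abs_mult)
        moreover have "sqrt (real n) * \<bar>\<phi> n ?x j - p j\<bar> \<le> sup_quantile N (Y (\<phi> n ?x)) \<alpha>"
          using cov mem_band_iff[OF prob_vectorsD(1)[OF p] elim(5)] by simp
        ultimately show ?thesis using q elim(3) by simp
      qed
      then show ?thesis using \<omega> by simp
    qed
    then have "?cov \<subseteq> ?good \<union> ?bad"
      by (auto simp: not_le[symmetric])
    then have "prob ?cov \<le> prob (?good \<union> ?bad)"
      using ev by (intro finite_measure_mono) auto
    also have "\<dots> \<le> prob ?good + prob ?bad"
      using ev by (intro measure_Un_le) auto
    finally show ?case
      unfolding coverage_def using elim(1,2) b2 h by linarith
  qed
qed

end

end

text \<open>Below 0 the tail probability is 1, which differs from \<alpha>, so every solution is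
  nonnegative; so is the default value 0 used for point masses.\<close>

lemma sup_quantile_nonneg:
  assumes N: "prob_space N" and gp: "gaussian_process N f y" and \<alpha>: "\<alpha> < 1"
  shows "0 \<le> sup_quantile N y \<alpha>"
proof -
  interpret N: prob_space N by (rule N)
  define tail where "tail q = measure N {\<omega> \<in> space N. lnorm \<infinity> (\<lambda>j. y j \<omega>) > q}" for q
  have "tail q \<noteq> \<alpha>" if "q < 0" for q
  proof -
    have "q < lnorm \<infinity> (\<lambda>j. y j \<omega>)" if "\<omega> \<in> space N" for \<omega>
      using l2_sup_attained[OF N.gaussian_process_l2[OF gp that]] \<open>q < 0\<close> by force
    then have "{\<omega> \<in> space N. lnorm \<infinity> (\<lambda>j. y j \<omega>) > q} = space N" by blast
    then show ?thesis using \<alpha> by (simp add: tail_def N.prob_space)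
  qed
  then have "0 \<le> (SOME q. tail q = \<alpha>)" if "\<exists>q. tail q = \<alpha>"
    using someI_ex[OF that] by (meson not_le)
  then show ?thesis
    unfolding sup_quantile_def tail_def[symmetric] Let_def by simp
qed

text \<open>The data almost surely repeat one value, so the empirical vector equals p, closeness
  with b = 0 gives the estimator p, and a band of any nonnegative width contains it.\<close>

lemma (in band_setup) coverage_point_mass:
  assumes j0: "p j0 = 1"
    and close: "\<And>n x b j. freq_data J n x \<Longrightarrow> 0 < n \<Longrightarrow> \<forall>j. \<bar>emp n x j - p j\<bar> \<le> b \<Longrightarrow> \<bar>\<phi> n x j - p j\<bar> \<le> b"
    and \<phi>: "\<And>n x. freq_data J n x \<Longrightarrow> 0 < n \<Longrightarrow> \<phi> n x \<in> prob_vectors J"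
    and n: "0 < n"
  shows "coverage \<phi> n = 1"
proof -
  have pj: "p j = (if j = j0 then 1 else 0)" for j
  proof (cases "j = j0")
    case False
    then have "p j + p j0 \<le> 1"
      using sum_le_suminf[of p "{j, j0}"] prob_vectorsD[OF p] by (auto simp: sums_iff)
    then show ?thesis using False j0 prob_vectorsD(1)[OF p, of j] by simp
  qed (simp add: j0)
  have "AE \<omega> in M. c i \<omega> = j0" for i
    using law[of i j0] j0 AE_prob_1[of "{\<omega> \<in> space M. c i \<omega> = j0}"] by simp
  then have "AE \<omega> in M. \<forall>i. c i \<omega> = j0"
    by (simp add: AE_all_countable)
  then have "AE \<omega> in M. \<omega> \<in> {\<omega> \<in> space M. \<forall>j. p j \<in> band (\<phi> n (cnt n \<omega>)) (sup_quantile N (Y (\<phi> n (cnt n \<omega>))) \<alpha>) n j}"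
    using AE_space
  proof eventually_elim
    case (elim \<omega>)
    let ?x = "cnt n \<omega>"
    note x = freq_data_cnt[OF elim(2), of n]
    have "emp n ?x j = p j" for j
      using elim(1) n by (simp add: emp_def cnt_def pj)
    then have "\<bar>\<phi> n ?x j - p j\<bar> \<le> 0" for j
      by (intro close x n) simp
    then have "sqrt (real n) * \<bar>\<phi> n ?x j - p j\<bar> \<le> sup_quantile N (Y (\<phi> n ?x)) \<alpha>" for j
      using sup_quantile_nonneg[OF N.prob_space_axioms gauss[OF \<phi>[OF x n]] \<alpha>(2)] by simp
    then show ?case
      using elim(2) mem_band_iff[OF prob_vectorsD(1)[OF p] n] by simp
  qed
  then show ?thesis
    unfolding coverage_def by (subst prob_eq_1) (auto intro: cnt_event)
qed

text \<open>An isotonic p is itself a competitor at distance 0, so the minimal distance is 0 and the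
  minimizer is p.\<close>

lemma isotonic_regression_fixed_iff:
  assumes p: "p \<in> prob_vectors J" and reg: "is_isotonic_regression J s r \<Psi>"
  shows "\<Psi> p = p \<longleftrightarrow> isotonic J s r p"
proof -
  have min: "\<Psi> p \<in> isotonic_prob_vectors J s r"
    "\<And>f. f \<in> isotonic_prob_vectors J s r \<Longrightarrow> (\<Sum>j. (\<Psi> p j - p j)\<^sup>2) \<le> (\<Sum>j. (f j - p j)\<^sup>2)"
    using reg p by (auto simp: is_isotonic_regression_def is_arg_min_linorder)
  show ?thesis
  proof
    assume "\<Psi> p = p"
    then show "isotonic J s r p" using min(1) by (simp add: isotonic_prob_vectors_def)
  next
    assume "isotonic J s r p"
    then have le: "(\<Sum>j. (\<Psi> p j - p j)\<^sup>2) \<le> 0"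
      using min(2)[of p] p by (simp add: isotonic_prob_vectors_def)
    have \<Psi>: "\<Psi> p \<in> prob_vectors J" using min(1) by (simp add: isotonic_prob_vectors_def)
    have "summable (\<lambda>j. \<Psi> p j * \<Psi> p j - 2 * (\<Psi> p j * p j) + p j * p j)"
      by (intro summable_add summable_diff summable_mult summable_prob_mult[OF \<Psi> \<Psi>]
          summable_prob_mult[OF \<Psi> p] summable_prob_mult[OF p p])
    then have sm: "summable (\<lambda>j. (\<Psi> p j - p j)\<^sup>2)"
      by (simp add: power2_eq_square algebra_simps)
    have "(\<Psi> p k - p k)\<^sup>2 \<le> (\<Sum>j. (\<Psi> p j - p j)\<^sup>2)" for k
      using sum_le_suminf[OF sm, of "{k}"] by simp
    then have "(\<Psi> p k - p k)\<^sup>2 \<le> 0" for k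
      using le by (rule order_trans)
    then show "\<Psi> p = p" by (auto simp: fun_eq_iff)
  qed
qed

section \<open>The stacked estimator as a convex combination\<close>

lemma stacked_prob_vectors:
  assumes "\<forall>f\<in>prob_vectors J. \<Psi> f \<in> prob_vectors J" and e: "emp n x \<in> prob_vectors J"
  shows "stacked d \<Psi> n x \<in> prob_vectors J"
proof -
  let ?\<beta> = "mixture_beta d \<Psi> n x"
  have \<Psi>: "\<Psi> (emp n x) \<in> prob_vectors J" using assms by blast
  have "(\<lambda>j. ?\<beta> * \<Psi> (emp n x) j + (1 - ?\<beta>) * emp n x j) sums (?\<beta> * 1 + (1 - ?\<beta>) * 1)"
    by (intro sums_add sums_mult prob_vectorsD(2)[OF \<Psi>] prob_vectorsD(2)[OF e])
  moreover have "0 \<le> ?\<beta> * \<Psi> (emp n x) j + (1 - ?\<beta>) * emp n x j" for j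
    using mixture_beta_range[of d \<Psi> n x] prob_vectorsD(1)[OF \<Psi>, of j] prob_vectorsD(1)[OF e, of j]
    by simp
  moreover have "\<Psi> (emp n x) j = 0" "emp n x j = 0" if "j \<notin> J" for j
    using \<Psi> e that by (simp_all add: prob_vectors_def)
  ultimately show ?thesis
    unfolding prob_vectors_def stacked_def[abs_def] by simp
qed

lemma stacked_diff_emp:
  assumes "\<forall>f\<in>prob_vectors J. \<Psi> f \<in> prob_vectors J" and e: "emp n x \<in> prob_vectors J"
  shows "\<bar>stacked d \<Psi> n x j - emp n x j\<bar> \<le> mixture_beta d \<Psi> n x"
proof -
  have \<Psi>: "\<Psi> (emp n x) \<in> prob_vectors J" using assms by blast
  have "stacked d \<Psi> n x j - emp n x j = mixture_beta d \<Psi> n x * (\<Psi> (emp n x) j - emp n x j)"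
    by (simp add: stacked_def algebra_simps)
  then show ?thesis
    using mixture_beta_range[of d \<Psi> n x] prob_vectors_diff_le_1[OF \<Psi> e, of j]
    by (simp add: abs_mult mult_left_le)
qed

text \<open>Contraction towards the fixed point puts both components into the same sup-norm ball
  around p, and the ball is convex; the value of the mixture parameter does not matter.\<close>

lemma stacked_near_fixed_point:
  assumes maps: "\<forall>f\<in>prob_vectors J. \<Psi> f \<in> prob_vectors J" and contr: "linf_contraction J \<Psi>"
    and e: "emp n x \<in> prob_vectors J" and p: "p \<in> prob_vectors J" "\<Psi> p = p"
    and b: "\<forall>j. \<bar>emp n x j - p j\<bar> \<le> b"
  shows "\<bar>stacked d \<Psi> n x j - p j\<bar> \<le> b"
proof -
  let ?\<beta> = "mixture_beta d \<Psi> n x"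
  have "\<bar>\<Psi> (emp n x) j - p j\<bar> \<le> b"
    using linf_contractionD[OF contr maps e p(1), of b j] b p(2) by simp
  then have "?\<beta> * \<bar>\<Psi> (emp n x) j - p j\<bar> + (1 - ?\<beta>) * \<bar>emp n x j - p j\<bar> \<le> ?\<beta> * b + (1 - ?\<beta>) * b"
    using mixture_beta_range[of d \<Psi> n x] b by (intro add_mono mult_left_mono) auto
  moreover have "stacked d \<Psi> n x j - p j = ?\<beta> * (\<Psi> (emp n x) j - p j) + (1 - ?\<beta>) * (emp n x j - p j)"
    by (simp add: stacked_def algebra_simps)
  moreover have "\<bar>?\<beta> * (\<Psi> (emp n x) j - p j) + (1 - ?\<beta>) * (emp n x j - p j)\<bar>
      \<le> ?\<beta> * \<bar>\<Psi> (emp n x) j - p j\<bar> + (1 - ?\<beta>) * \<bar>emp n x j - p j\<bar>"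
    using mixture_beta_range[of d \<Psi> n x] by (intro order.trans[OF abs_triangle_ineq]) (simp add: abs_mult)
  ultimately show ?thesis by (simp add: algebra_simps)
qed

text \<open>Observations are replaced by their indices in J, and time is shifted from
  \<open>{1..}\<close> to all natural numbers.\<close>

lemma iid_index_of_data:
  assumes S_enum: "bij_betw s J S" and p: "p \<in> prob_vectors J" and M: "prob_space M"
    and indep: "prob_space.indep_vars M (\<lambda>_. count_space S) z {1..}"
    and pmf: "\<forall>i\<ge>1. \<forall>j\<in>J. measure M {\<omega> \<in> space M. z i \<omega> = s j} = p j"
  shows "iid_index M J (\<lambda>i \<omega>. the_inv_into J s (z (Suc i) \<omega>)) p"
proof -
  interpret prob_space M by (rule M)
  let ?c = "\<lambda>i \<omega>. the_inv_into J s (z (Suc i) \<omega>)"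
  have inj: "inj_on s J" and img: "s ` J = S"
    using S_enum by (auto simp: bij_betw_def)
  have zS: "z (Suc i) \<omega> \<in> S" if "\<omega> \<in> space M" for i \<omega>
  proof -
    have "z (Suc i) \<in> measurable M (count_space S)"
      using indep by (simp add: indep_vars_def2)
    from measurable_space[OF this that] show ?thesis by simp
  qed
  have cJ: "?c i \<omega> \<in> J" and sc: "s (?c i \<omega>) = z (Suc i) \<omega>" if "\<omega> \<in> space M" for i \<omega>
    using zS[OF that, of i] img
    by (auto intro!: the_inv_into_into[OF inj] f_the_inv_into_f[OF inj])
  show ?thesis
  proof
    \<comment> \<open>Reindexing by \<open>Suc\<close> is obtained by grouping the observations into
      singleton blocks and then reading off the only component of each block.\<close>
    have "indep_vars (\<lambda>i. PiM {Suc i} (\<lambda>_. count_space S)) (\<lambda>i \<omega>. \<lambda>k\<in>{Suc i}. z k \<omega>) UNIV"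
      by (rule indep_vars_restrict[OF indep]) (auto simp: disjoint_family_on_def)
    then have "indep_vars (\<lambda>_. count_space UNIV)
        (\<lambda>i \<omega>. the_inv_into J s ((\<lambda>k\<in>{Suc i}. z k \<omega>) (Suc i))) UNIV"
    proof (rule indep_vars_compose2)
      fix i
      have "(\<lambda>f. f (Suc i)) \<in> measurable (PiM {Suc i} (\<lambda>_. count_space S)) (count_space S)"
        by (rule measurable_component_singleton) simp
      from measurable_compose[OF this, of "the_inv_into J s" "count_space UNIV"]
      show "(\<lambda>f. the_inv_into J s (f (Suc i))) \<in> measurable (PiM {Suc i} (\<lambda>_. count_space S)) (count_space UNIV)"
        by simp
    qed
    then show "indep_vars (\<lambda>_. count_space UNIV) ?c UNIV"
      by simp
    show "?c i \<omega> \<in> J" if "\<omega> \<in> space M" for i \<omega> by (rule cJ[OF that])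
    show "prob {\<omega> \<in> space M. ?c i \<omega> = j} = p j" for i j
    proof (cases "j \<in> J")
      case True
      then have "?c i \<omega> = j \<longleftrightarrow> z (Suc i) \<omega> = s j" if "\<omega> \<in> space M" for \<omega>
        using sc[OF that, of i] the_inv_into_f_f[OF inj True] by metis
      then have "{\<omega> \<in> space M. ?c i \<omega> = j} = {\<omega> \<in> space M. z (Suc i) \<omega> = s j}" by blast
      then show ?thesis using pmf True by simp
    next
      case False
      then have "{\<omega> \<in> space M. ?c i \<omega> = j} = {}" using cJ by blast
      then have "prob {\<omega> \<in> space M. ?c i \<omega> = j} = 0" by (simp only: measure_empty)
      then show ?thesis using False p by (simp add: prob_vectors_def)
    qed
  qed (rule p)
qed

lemma freq_eq_card:
  assumes inj: "inj_on s J" and z: "\<And>i. z (Suc i) \<omega> \<in> s ` J"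
  shows "freq J s z n \<omega> j = card {i. i < n \<and> the_inv_into J s (z (Suc i) \<omega>) = j}"
proof (cases "j \<in> J")
  case True
  have iff: "the_inv_into J s (z (Suc i) \<omega>) = j \<longleftrightarrow> z (Suc i) \<omega> = s j" for i
    using f_the_inv_into_f[OF inj z[of i]] the_inv_into_f_f[OF inj True] by metis
  have "bij_betw Suc {i. i < n \<and> z (Suc i) \<omega> = s j} {i \<in> {1..n}. z i \<omega> = s j}"
  proof (rule bij_betw_imageI)
    show "Suc ` {i. i < n \<and> z (Suc i) \<omega> = s j} = {i \<in> {1..n}. z i \<omega> = s j}"
    proof safe
      fix i assume "i \<in> {1..n}" "z i \<omega> = s j"
      then show "i \<in> Suc ` {i. i < n \<and> z (Suc i) \<omega> = s j}"
        by (intro image_eqI[of _ _ "i - 1"]) auto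
    qed auto
  qed simp
  then show ?thesis
    using True unfolding freq_def iff by (simp only: if_True bij_betw_same_card)
next
  case False
  then have "the_inv_into J s (z (Suc i) \<omega>) \<noteq> j" for i
    using the_inv_into_into[OF inj z[of i] order_refl] by auto
  then show ?thesis using False by (simp add: freq_def)
qed

text \<open>For a point mass p the process vanishes almost surely, its sup-norm has tail
  probabilities 0 and 1 only, and no number is an \<alpha>-quantile. The exact limit is therefore
  stated for p other than a point mass; the conservative bound includes point masses through the
  default quantile 0.\<close>

theorem mainTheorem6:
  fixes M :: "'a measure" and N :: "'b measure"
    and S :: "'s set" and r :: "('s \<times> 's) set" and J :: "nat set" and s :: "nat \<Rightarrow> 's"
    and z :: "nat \<Rightarrow> 'a \<Rightarrow> 's"
    and p :: "nat \<Rightarrow> real"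
    and \<Psi> :: "(nat \<Rightarrow> real) \<Rightarrow> nat \<Rightarrow> real"
    and Y :: "(nat \<Rightarrow> real) \<Rightarrow> nat \<Rightarrow> 'b \<Rightarrow> real"
    and \<alpha> :: real and d :: nat
  assumes S_enum: "bij_betw s J S" and order: "partial_order_on S r"
    and p: "p \<in> prob_vectors J"
    and data_space: "prob_space M"
    and indep: "prob_space.indep_vars M (\<lambda>_. count_space S) z {1..}"
    and pmf: "\<forall>i\<ge>1. \<forall>j\<in>J. measure M {\<omega> \<in> space M. z i \<omega> = s j} = p j"
    and gauss_space: "prob_space N"
    and gauss: "\<forall>f\<in>prob_vectors J. gaussian_process N f (Y f)"
    and \<alpha>: "0 < \<alpha>" "\<alpha> < 1" and d: "d \<in> {1, 2}"
    and maps: "\<forall>f\<in>prob_vectors J. \<Psi> f \<in> prob_vectors J"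
    and i: "l2_continuous J \<Psi>"
    and ii: "linf_contraction J \<Psi>"
    and iii: "projection_like J \<Psi>"
    and iv: "loo_dominated J \<Psi>"
    and v: "\<Psi> p = p \<longrightarrow>
        (\<forall>k\<ge>2. bounded_in_prob M (\<lambda>n \<omega>.
            sqrt (real n) * lnorm k (\<lambda>j. \<Psi> (emp n (freq J s z n \<omega>)) j - p j))) \<and>
        (summable (\<lambda>j. sqrt (p j)) \<longrightarrow> bounded_in_prob M (\<lambda>n \<omega>.
            sqrt (real n) * lnorm 1 (\<lambda>j. \<Psi> (emp n (freq J s z n \<omega>)) j - p j)))"
  defines "\<phi> \<equiv> \<lambda>n \<omega>. stacked d \<Psi> n (freq J s z n \<omega>)"
  defines "q \<equiv> \<lambda>n \<omega>. sup_quantile N (Y (\<phi> n \<omega>)) \<alpha>"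
  defines "coverage \<equiv> \<lambda>n. measure M {\<omega> \<in> space M. \<forall>j. p j \<in> band (\<phi> n \<omega>) (q n \<omega>) n j}"
  shows "(\<Psi> p \<noteq> p \<and> (\<forall>j. p j \<noteq> 1) \<longrightarrow> coverage \<longlonglongrightarrow> 1 - \<alpha>)
       \<and> (\<Psi> p = p \<longrightarrow> ereal (1 - \<alpha>) \<le> liminf (\<lambda>n. ereal (coverage n)))
       \<and> (is_isotonic_regression J s r \<Psi> \<longrightarrow> (\<Psi> p = p \<longleftrightarrow> isotonic J s r p))"
proof (intro conjI impI)
  define c where "c i \<omega> = the_inv_into J s (z (Suc i) \<omega>)" for i \<omega>
  interpret M: prob_space M by (rule data_space)
  interpret B: band_setup M J c p N Y \<alpha>
    unfolding band_setup_def band_setup_axioms_def c_def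
    using iid_index_of_data[OF S_enum p data_space indep pmf] gauss_space gauss \<alpha> by blast
  have freq: "freq J s z n \<omega> = B.cnt n \<omega>" if "\<omega> \<in> space M" for n \<omega>
  proof
    have "z (Suc i) \<omega> \<in> s ` J" for i
    proof -
      have "z (Suc i) \<in> measurable M (count_space S)"
        using indep by (simp add: M.indep_vars_def2)
      from measurable_space[OF this that] show ?thesis
        using S_enum by (simp add: bij_betw_def)
    qed
    then show "freq J s z n \<omega> j = B.cnt n \<omega> j" for j
      using S_enum by (simp add: freq_eq_card bij_betw_def B.cnt_def c_def)
  qed
  have cov: "coverage = B.coverage (stacked d \<Psi>)"
    unfolding coverage_def B.coverage_def \<phi>_def q_def
    by (intro ext arg_cong[where f = "measure M"] Collect_cong conj_cong refl) (simp only: freq)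
  have stk: "stacked d \<Psi> n x \<in> prob_vectors J" if "freq_data J n x" "0 < n" for n x
    using that by (intro stacked_prob_vectors[OF maps] emp_prob_vectors) auto
  have ex_pos: "\<exists>j. 0 < p j"
  proof (rule ccontr)
    assume "\<not> ?thesis"
    then have "p = (\<lambda>_. 0)"
      using prob_vectorsD(1)[OF p] by (intro ext) (metis less_eq_real_def)
    then have "p sums 0" by simp
    then show False using sums_unique2[OF prob_vectorsD(2)[OF p], of 0] by simp
  qed
  have nondeg: "\<exists>j0. 0 < p j0 \<and> p j0 < 1" if "\<forall>j. p j \<noteq> 1"
    using ex_pos that prob_vectorsD(3)[OF p] by (metis order_less_le)
  show "coverage \<longlonglongrightarrow> 1 - \<alpha>" if ne: "\<Psi> p \<noteq> p \<and> (\<forall>j. p j \<noteq> 1)"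
  proof -
    obtain j0 where j0: "0 < p j0" "p j0 < 1" using nondeg ne by blast
    obtain \<delta> C n0 where \<delta>: "0 < \<delta>" and beta: "\<And>n x. n \<ge> n0 \<Longrightarrow> freq_data J n x \<Longrightarrow>
        \<forall>j. \<bar>emp n x j - p j\<bar> < \<delta> \<Longrightarrow> mixture_beta d \<Psi> n x \<le> C / real n"
      using mixture_beta_small[OF maps ii iii p, of d] ne by blast
    \<comment> \<open>The constant from the bound on the mixture parameter comes without a sign,
      while the coverage bounds ask for a nonnegative one.\<close>
    define C' where "C' = max C 0"
    have close: "\<bar>stacked d \<Psi> n x j - emp n x j\<bar> \<le> C' / real n"
      if "n \<ge> max n0 1" "freq_data J n x" "\<forall>j. \<bar>emp n x j - p j\<bar> < \<delta>" for n x j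
    proof -
      have "\<bar>stacked d \<Psi> n x j - emp n x j\<bar> \<le> mixture_beta d \<Psi> n x"
        using that by (intro stacked_diff_emp[OF maps] emp_prob_vectors) auto
      also have "\<dots> \<le> C / real n" using that by (intro beta) auto
      also have "\<dots> \<le> C' / real n" by (intro divide_right_mono) (auto simp: C'_def)
      finally show ?thesis .
    qed
    have close': "\<bar>stacked d \<Psi> n x j - p j\<bar> \<le> b + C' / real n"
      if "n \<ge> max n0 1" "freq_data J n x" "\<forall>j. \<bar>emp n x j - p j\<bar> < \<delta>" "\<forall>j. \<bar>emp n x j - p j\<bar> \<le> b" for n x b j
      using close[OF that(1-3), of j] that(4)[rule_format, of j] by linarith
    have C': "0 \<le> C'" by (simp add: C'_def)
    show ?thesis
    proof (rule tendstoI)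
      fix e :: real assume e: "0 < e"
      then have e2: "0 < e / 2" by simp
      have "\<forall>\<^sub>F n in sequentially. 1 - \<alpha> - e / 2 \<le> coverage n"
        unfolding cov by (rule B.coverage_lower[OF j0 stk \<delta> C' close' e2])
      moreover have "\<forall>\<^sub>F n in sequentially. coverage n \<le> 1 - \<alpha> + e / 2"
        unfolding cov by (rule B.coverage_upper[OF j0 stk \<delta> C' close e2])
      ultimately show "\<forall>\<^sub>F n in sequentially. dist (coverage n) (1 - \<alpha>) < e"
        by eventually_elim (use e in \<open>auto simp: dist_real_def abs_less_iff\<close>)
    qed
  qed
  show "ereal (1 - \<alpha>) \<le> liminf (\<lambda>n. ereal (coverage n))" if fp: "\<Psi> p = p"
  proof (cases "\<exists>j. p j = 1")
    case True
    then obtain j0 where j0: "p j0 = 1" by blast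
    have cov1: "coverage n = 1" if "0 < n" for n
      unfolding cov
    proof (rule B.coverage_point_mass[OF j0 _ stk that])
      show "\<bar>stacked d \<Psi> n x j - p j\<bar> \<le> b"
        if "freq_data J n x" "0 < n" "\<forall>j. \<bar>emp n x j - p j\<bar> \<le> b" for n x b j
        using that by (intro stacked_near_fixed_point[OF maps ii emp_prob_vectors p fp]) auto
    qed
    have "\<forall>\<^sub>F n in sequentially. ereal (1 - \<alpha>) \<le> ereal (coverage n)"
      using eventually_gt_at_top[of "0 :: nat"] by eventually_elim (use \<alpha> in \<open>simp add: cov1\<close>)
    then show ?thesis by (rule Liminf_bounded)
  next
    case False
    then obtain j0 where j0: "0 < p j0" "p j0 < 1" using nondeg by blast
    \<comment> \<open>At a fixed point the estimate holds for all data, so any radius will do; here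
      it is 1, and C = 0.\<close>
    have close: "\<bar>stacked d \<Psi> n x j - p j\<bar> \<le> b + 0 / real n"
      if "n \<ge> 1" "freq_data J n x" "\<forall>j. \<bar>emp n x j - p j\<bar> < 1" "\<forall>j. \<bar>emp n x j - p j\<bar> \<le> b" for n x b j
      using stacked_near_fixed_point[OF maps ii emp_prob_vectors[OF that(2,1)] p fp that(4)] by simp
    have lower: "\<forall>\<^sub>F n in sequentially. 1 - \<alpha> - e \<le> coverage n" if "0 < e" for e
      unfolding cov by (rule B.coverage_lower[OF j0 stk zero_less_one order_refl close that])
    show ?thesis
      unfolding le_Liminf_iff
    proof (intro allI impI)
      fix y assume y: "y < ereal (1 - \<alpha>)"
      \<comment> \<open>y may be minus infinity, so a real number between y and 1 - \<alpha> is
        inserted to obtain a real error for the lower bound.\<close>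
      then obtain y' where y': "y < ereal y'" "y' < 1 - \<alpha>"
        using ereal_dense2[OF y] by auto
      from lower[of "1 - \<alpha> - y'"] y'(2) have "\<forall>\<^sub>F n in sequentially. y' \<le> coverage n" by simp
      then show "\<forall>\<^sub>F n in sequentially. y < ereal (coverage n)"
        by eventually_elim (rule less_le_trans[OF y'(1)], simp)
    qed
  qed
  show "\<Psi> p = p \<longleftrightarrow> isotonic J s r p" if "is_isotonic_regression J s r \<Psi>"
    by (rule isotonic_regression_fixed_iff[OF p that])
qed

end
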